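(* Let $(\rho_L,u_L)$ and $(\rho_R,u_R)$ be fixed states with $\rho_L>0$ and $\rho_R>0$. Then for every $\theta\ge0$ there exists a unique Riemann solution $(\rho^{(\theta)},u^{(\theta)})$ (in the sense of the context) of the Euler system with pressure $p^{(\theta)}(\rho)=\frac{\rho^{2\theta+1}}{2\theta+1}$ and initial data equal to $(\rho_L,u_L)$ for $x<0$ and $(\rho_R,u_R)$ for $x>0$. Moreover, $(\rho^{(\theta)},u^{(\theta)})\to(\rho^{(0)},u^{(0)})$ pointwise for a.e. $(t,x)\in(0,\infty)\times\mathbb{R}$ as $\theta\to0$.
   Context: For $\theta\ge0$ the system is $\partial_t\rho+\partial_x(\rho u)=0$, $\partial_t(\rho u)+\partial_x(\rho u^2+p^{(\theta)}(\rho))=0$ with $p^{(\theta)}(\rho)=\rho^{2\theta+1}/(2\theta+1)$ (isothermal, $p=\rho$, if $\theta=0$). The eigenvalues are $\lambda_j^{(\theta)}(\rho,u)=u+(-1)^j\rho^\theta$, $j=1,2$ (so $\lambda_j^{(0)}=u+(-1)^j$). The Riemann invariants are $w_j^{(\theta)}(\rho,u)=u+(-1)^{j+1}\rho^\theta/\theta$ for $\theta>0$ and $w_j^{(0)}(\rho,u)=\rho\,e^{(-1)^{j+1}u}$ for $\theta=0$. Elementary waves connecting a left state $(\rho_-,u_-)$ to a right state $(\rho_+,u_+)$ (both with positive density): Shock waves $S_j^{(\theta)}$: $$u_+=u_--\sqrt{\Big(\frac1{\rho_-}-\frac1{\rho_+}\Big)\frac{\rho_+^{2\theta+1}-\rho_-^{2\theta+1}}{2\theta+1}},\qquad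 u_->u_+,$$ with $\rho_-<\rho_+$ for $j=1$ and $\rho_->\rho_+$ for $j=2$; the solution equals $(\rho_-,u_-)$ for $x<\sigma t$ and $(\rho_+,u_+)$ for $x>\sigma t$, where $\sigma=\frac{\rho_+u_+-\rho_-u_-}{\rho_+-\rho_-}$. Rarefaction waves $R_j^{(\theta)}$: $w_j^{(\theta)}(\rho_+,u_+)=w_j^{(\theta)}(\rho_-,u_-)=:w_j$, $u_-<u_+$, with $\rho_->\rho_+$ for $j=1$ and $\rho_-<\rho_+$ for $j=2$; the solution equals $(\rho_-,u_-)$ for $x\le\lambda_j^{(\theta)}(\rho_-,u_-)t$, equals $(\rho_+,u_+)$ for $x\ge\lambda_j^{(\theta)}(\rho_+,u_+)t$, and in between equals $$\Big(\Big(\tfrac{(-1)^j\theta(\frac xt-w_j)}{\theta+1}\Big)^{1/\theta},\ \tfrac{\frac xt+\theta w_j}{\theta+1}\Big)\ \text{ if }\theta>0,\qquad \Big(w_je^{(-1)^j\frac xt-1},\ \tfrac xt-(-1)^j\Big)\ \text{ if }\theta=0 .$$ A Riemann solution is a function of $x/t$ ($t>0$) of one of the following two types. (1) It consists of a 1-wave ($S_1^{(\theta)}$, $R_1^{(\theta)}$, or trivial) connecting $(\rho_L,u_L)$ to a constant middle state $(\rho_M,u_M)$ with $\rho_M>0$, followed by a 2-wave ($S_2^{(\theta)}$, $R_2^{(\theta)}$, or trivial) connecting $(\rho_M,u_M)$ to $(\rho_R,u_R)$. (2) (only for $\theta>0$ and when $\xi_1:=u_L+\rho_L^\theta/\theta\le\xi_2:=u_R-\rho_R^\theta/\theta$)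 It has a vacuum middle state, $\rho_M=0$: it equals $(\rho_L,u_L)$ for $x/t\le\lambda_1^{(\theta)}(\rho_L,u_L)$, the $R_1^{(\theta)}$ formula with $w_1=\xi_1$ for $\lambda_1^{(\theta)}(\rho_L,u_L)<x/t<\xi_1$, has $\rho=0$ for $\xi_1\le x/t\le\xi_2$, equals the $R_2^{(\theta)}$ formula with $w_2=\xi_2$ for $\xi_2<x/t<\lambda_2^{(\theta)}(\rho_R,u_R)$, and equals $(\rho_R,u_R)$ for $x/t\ge\lambda_2^{(\theta)}(\rho_R,u_R)$. The velocity is left undefined on the vacuum set. Uniqueness is meant within this class (up to values on the shock lines; the velocity being considered only where $\rho>0$). The velocity convergence is considered for $\theta$ small enough that $\rho^{(\theta)}>0$. *)

theory Defs
  imports "HOL-Analysis.Analysis"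
begin

text \<open>States are pairs (density, velocity). The parameter \<open>\<theta> = 0\<close> is the isothermal case.\<close>

type_synonym state = "real \<times> real"

definition pressure :: "real \<Rightarrow> real \<Rightarrow> real" where
  "pressure \<theta> \<rho> = \<rho> powr (2 * \<theta> + 1) / (2 * \<theta> + 1)"

text \<open>Only evaluated at positive densities, where \<open>\<rho> powr 0 = 1\<close>.\<close>

definition eigenvalue :: "nat \<Rightarrow> real \<Rightarrow> state \<Rightarrow> real" where
  "eigenvalue j \<theta> = (\<lambda>(\<rho>, u). u + (-1) ^ j * \<rho> powr \<theta>)"

definition riemann_invariant :: "nat \<Rightarrow> real \<Rightarrow> state \<Rightarrow> real" where
  "riemann_invariant j \<theta> = (\<lambda>(\<rho>, u).
     if \<theta> = 0 then \<rho> * exp ((-1) ^ (j + 1) * u)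
     else u + (-1) ^ (j + 1) * \<rho> powr \<theta> / \<theta>)"

definition shock_states :: "nat \<Rightarrow> real \<Rightarrow> state \<Rightarrow> state \<Rightarrow> bool" where
  "shock_states j \<theta> = (\<lambda>(\<rho>m, um) (\<rho>p, up).
     up = um - sqrt ((1 / \<rho>m - 1 / \<rho>p) * (pressure \<theta> \<rho>p - pressure \<theta> \<rho>m)) \<and>
     up < um \<and> (if j = 1 then \<rho>m < \<rho>p else \<rho>p < \<rho>m))"

definition shock_speed :: "state \<Rightarrow> state \<Rightarrow> real" where
  "shock_speed = (\<lambda>(\<rho>m, um) (\<rho>p, up). (\<rho>p * up - \<rho>m * um) / (\<rho>p - \<rho>m))"

definition rarefaction_states :: "nat \<Rightarrow> real \<Rightarrow> state \<Rightarrow> state \<Rightarrow> bool" where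
  "rarefaction_states j \<theta> = (\<lambda>(\<rho>m, um) (\<rho>p, up).
     riemann_invariant j \<theta> (\<rho>p, up) = riemann_invariant j \<theta> (\<rho>m, um) \<and>
     um < up \<and> (if j = 1 then \<rho>p < \<rho>m else \<rho>m < \<rho>p))"

definition fan_state :: "nat \<Rightarrow> real \<Rightarrow> real \<Rightarrow> real \<Rightarrow> state" where
  "fan_state j \<theta> w \<xi> =
     (if \<theta> = 0 then (w * exp ((-1) ^ j * \<xi> - 1), \<xi> - (-1) ^ j)
      else (((-1) ^ j * \<theta> * (\<xi> - w) / (\<theta> + 1)) powr (1 / \<theta>), (\<xi> + \<theta> * w) / (\<theta> + 1)))"

text \<open>
  \<open>elementary_wave j \<theta> l r a b S V\<close>: the function \<open>V\<close> of \<open>\<xi> = x / t\<close> is a \<open>j\<close>-wave (or a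
  trivial wave) connecting \<open>l\<close> to \<open>r\<close> inside \<open>a \<le> \<xi> \<le> b\<close>, and \<open>S\<close> is the set of its shock
  speeds. The value of \<open>V\<close> on a shock line is unconstrained, and the location of a trivial
  wave is arbitrary.
\<close>

inductive elementary_wave ::
  "nat \<Rightarrow> real \<Rightarrow> state \<Rightarrow> state \<Rightarrow> real \<Rightarrow> real \<Rightarrow> real set \<Rightarrow> (real \<Rightarrow> state) \<Rightarrow> bool"
  for j :: nat and \<theta> :: real and l r :: state where
  trivial:
    "\<lbrakk>0 < fst l; l = r; \<forall>\<xi>. V \<xi> = l\<rbrakk> \<Longrightarrow> elementary_wave j \<theta> l r c c {} V"
| shock:
    "\<lbrakk>0 < fst l; 0 < fst r; shock_states j \<theta> l r; \<sigma> = shock_speed l r;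
      \<forall>\<xi> < \<sigma>. V \<xi> = l; \<forall>\<xi> > \<sigma>. V \<xi> = r\<rbrakk>
     \<Longrightarrow> elementary_wave j \<theta> l r \<sigma> \<sigma> {\<sigma>} V"
| rarefaction:
    "\<lbrakk>0 < fst l; 0 < fst r; rarefaction_states j \<theta> l r;
      a = eigenvalue j \<theta> l; b = eigenvalue j \<theta> r;
      \<forall>\<xi> \<le> a. V \<xi> = l; \<forall>\<xi> \<ge> b. V \<xi> = r;
      \<forall>\<xi>. a < \<xi> \<and> \<xi> < b \<longrightarrow> V \<xi> = fan_state j \<theta> (riemann_invariant j \<theta> l) \<xi>\<rbrakk>
     \<Longrightarrow> elementary_wave j \<theta> l r a b {} V"

definition nonvacuum_profile ::
  "real \<Rightarrow> state \<Rightarrow> state \<Rightarrow> real set \<Rightarrow> (real \<Rightarrow> state) \<Rightarrow> bool" where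
  "nonvacuum_profile \<theta> L R S V \<longleftrightarrow>
     (\<exists>M a1 b1 S1 V1 a2 b2 S2 V2.
        0 < fst M \<and>
        elementary_wave 1 \<theta> L M a1 b1 S1 V1 \<and> elementary_wave 2 \<theta> M R a2 b2 S2 V2 \<and>
        b1 < a2 \<and> S = S1 \<union> S2 \<and>
        (\<forall>\<xi> \<le> b1. V \<xi> = V1 \<xi>) \<and>
        (\<forall>\<xi>. b1 < \<xi> \<and> \<xi> < a2 \<longrightarrow> V \<xi> = M) \<and>
        (\<forall>\<xi> \<ge> a2. V \<xi> = V2 \<xi>))"

text \<open>The velocity component of \<open>V\<close> is unconstrained on the vacuum set. Since \<open>\<theta> > 0\<close>, the
  bounds \<open>\<xi>1\<close> and \<open>\<xi>2\<close> are \<open>u\<^sub>L + \<rho>\<^sub>L powr \<theta> / \<theta>\<close> and \<open>u\<^sub>R - \<rho>\<^sub>R powr \<theta> / \<theta>\<close>.\<close>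

definition vacuum_profile :: "real \<Rightarrow> state \<Rightarrow> state \<Rightarrow> (real \<Rightarrow> state) \<Rightarrow> bool" where
  "vacuum_profile \<theta> L R V \<longleftrightarrow>
     0 < \<theta> \<and>
     (let \<xi>1 = riemann_invariant 1 \<theta> L; \<xi>2 = riemann_invariant 2 \<theta> R in
        \<xi>1 \<le> \<xi>2 \<and>
        (\<forall>\<xi> \<le> eigenvalue 1 \<theta> L. V \<xi> = L) \<and>
        (\<forall>\<xi>. eigenvalue 1 \<theta> L < \<xi> \<and> \<xi> < \<xi>1 \<longrightarrow> V \<xi> = fan_state 1 \<theta> \<xi>1 \<xi>) \<and>
        (\<forall>\<xi>. \<xi>1 \<le> \<xi> \<and> \<xi> \<le> \<xi>2 \<longrightarrow> fst (V \<xi>) = 0) \<and>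
        (\<forall>\<xi>. \<xi>2 < \<xi> \<and> \<xi> < eigenvalue 2 \<theta> R \<longrightarrow> V \<xi> = fan_state 2 \<theta> \<xi>2 \<xi>) \<and>
        (\<forall>\<xi> \<ge> eigenvalue 2 \<theta> R. V \<xi> = R))"

text \<open>
  \<open>riemann_solution \<theta> L R S \<rho> u\<close>: the functions \<open>\<rho>\<close>, \<open>u\<close> of \<open>(t, x)\<close>, regarded for \<open>t > 0\<close> only,
  form a Riemann solution for the initial data \<open>L\<close> (for \<open>x < 0\<close>) and \<open>R\<close> (for \<open>x > 0\<close>) whose
  shock lines are \<open>x = \<sigma> * t\<close> with \<open>\<sigma> \<in> S\<close>.
\<close>

definition riemann_solution ::
  "real \<Rightarrow> state \<Rightarrow> state \<Rightarrow> real set \<Rightarrow> (real \<Rightarrow> real \<Rightarrow> real) \<Rightarrow> (real \<Rightarrow> real \<Rightarrow> real) \<Rightarrow> bool" where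
  "riemann_solution \<theta> L R S \<rho> u \<longleftrightarrow>
     (\<exists>V. (nonvacuum_profile \<theta> L R S V \<or> S = {} \<and> vacuum_profile \<theta> L R V) \<and>
          (\<forall>t > 0. \<forall>x. (\<rho> t x, u t x) = V (x / t)))"

end

theory Submission
  imports Defs
begin

text \<open>
  The states joined to \<open>L\<close> by a 1-wave and those joined to \<open>R\<close> by a 2-wave form the curves
  \<open>u = u\<^sub>L - f\<^sub>\<theta>(\<rho>\<^sub>L, \<rho>)\<close> and \<open>u = u\<^sub>R + f\<^sub>\<theta>(\<rho>\<^sub>R, \<rho>)\<close>, where \<open>f\<^sub>\<theta>\<close> is continuous, strictly
  increasing in \<open>\<rho>\<close> and unbounded above. Hence there is at most one middle state, and there is one
  unless the infimum \<open>- (\<rho>\<^sub>L powr \<theta> + \<rho>\<^sub>R powr \<theta>) / \<theta>\<close> of \<open>f\<^sub>\<theta>(\<rho>\<^sub>L, \<rho>) + f\<^sub>\<theta>(\<rho>\<^sub>R, \<rho>)\<close> is at least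
  \<open>u\<^sub>L - u\<^sub>R\<close>, which is exactly the vacuum condition and fails for small \<open>\<theta>\<close>. Monotonicity turns
  the pointwise convergence \<open>f\<^sub>\<theta> \<longlongrightarrow> f\<^sub>0\<close> into convergence of the middle states; then all wave
  speeds converge, also when the limit wave is trivial, and the profiles converge at every
  \<open>\<xi> = x / t\<close> other than finitely many limit speeds.
\<close>

section \<open>Wave curves: monotonicity, continuity, growth, and the limit of vanishing
  \<theta>\<close>

text \<open>The function \<open>f\<^sub>\<theta>(\<rho>0, r)\<close> of the introduction.\<close>

definition wave_curve :: "real \<Rightarrow> real \<Rightarrow> real \<Rightarrow> real" where
  "wave_curve \<theta> \<rho>0 r =
     (if r \<le> \<rho>0 then (if \<theta> = 0 then ln r - ln \<rho>0 else (r powr \<theta> - \<rho>0 powr \<theta>) / \<theta>)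
      else sqrt ((1 / \<rho>0 - 1 / r) * (pressure \<theta> r - pressure \<theta> \<rho>0)))"

lemma pressure_strict_mono:
  assumes "0 \<le> \<theta>" "0 < r" "r < s"
  shows "pressure \<theta> r < pressure \<theta> s"
  using assms unfolding pressure_def
  by (intro divide_strict_right_mono powr_less_mono2) auto

lemma wave_curve_self [simp]: "wave_curve \<theta> r r = 0"
  by (simp add: wave_curve_def)

text \<open>On the rarefaction branch this is monotonicity of logarithm and powers. On the shock
  branch both factors under the root are nonnegative and strictly increasing. The branches meet at
  \<open>\<rho>0\<close> with value 0.\<close>

lemma wave_curve_strict_mono:
  assumes "0 \<le> \<theta>" "0 < \<rho>0" "0 < r" "r < s"
  shows "wave_curve \<theta> \<rho>0 r < wave_curve \<theta> \<rho>0 s"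
proof -
  have low: "wave_curve \<theta> \<rho>0 a < wave_curve \<theta> \<rho>0 b" if "0 < a" "a < b" "b \<le> \<rho>0" for a b
    using that assms(1)
    by (auto simp: wave_curve_def intro!: divide_strict_right_mono powr_less_mono2)
  have high: "wave_curve \<theta> \<rho>0 a < wave_curve \<theta> \<rho>0 b" if "\<rho>0 \<le> a" "a < b" for a b
  proof -
    have "(1 / \<rho>0 - 1 / a) * (pressure \<theta> a - pressure \<theta> \<rho>0)
        < (1 / \<rho>0 - 1 / b) * (pressure \<theta> b - pressure \<theta> \<rho>0)"
    proof (rule mult_strict_mono')
      show "0 \<le> pressure \<theta> a - pressure \<theta> \<rho>0"
        using pressure_strict_mono[of \<theta> \<rho>0 a] assms that by (cases "a = \<rho>0") auto
      show "0 \<le> 1 / \<rho>0 - 1 / a"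
        using assms that by (simp add: field_simps)
      show "1 / \<rho>0 - 1 / a < 1 / \<rho>0 - 1 / b"
        using assms that by (simp add: field_simps)
      show "pressure \<theta> a - pressure \<theta> \<rho>0 < pressure \<theta> b - pressure \<theta> \<rho>0"
        using pressure_strict_mono[of \<theta> a b] assms that by simp
    qed
    moreover have "wave_curve \<theta> \<rho>0 a = sqrt ((1 / \<rho>0 - 1 / a) * (pressure \<theta> a - pressure \<theta> \<rho>0))"
      using that by (cases "a = \<rho>0") (auto simp: wave_curve_def)
    ultimately show ?thesis
      using that by (simp add: wave_curve_def)
  qed
  consider "s \<le> \<rho>0" | "\<rho>0 \<le> r" | "r < \<rho>0" "\<rho>0 < s" by linarith
  then show ?thesis
  proof cases
    case 3
    then show ?thesis
      using low[of r \<rho>0] high[of \<rho>0 s] assms by simp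
  qed (use low high assms in auto)
qed

lemma continuous_on_wave_curve:
  assumes "0 \<le> \<theta>" "0 < \<rho>0"
  shows "continuous_on {0<..} (wave_curve \<theta> \<rho>0)"
proof -
  \<comment> \<open>Clamping with \<open>min\<close> and \<open>max\<close> replaces the case split
    by a sum of two functions continuous on all positive densities; for each \<open>r\<close> at
    least one summand vanishes.\<close>
  have eq: "wave_curve \<theta> \<rho>0 r =
      (if \<theta> = 0 then ln (min r \<rho>0) - ln \<rho>0 else (min r \<rho>0 powr \<theta> - \<rho>0 powr \<theta>) / \<theta>)
      + sqrt ((1 / \<rho>0 - 1 / max r \<rho>0) * (pressure \<theta> (max r \<rho>0) - pressure \<theta> \<rho>0))" for r
    by (auto simp: wave_curve_def min_def max_def)
  have pos: "min r \<rho>0 \<noteq> 0" "max r \<rho>0 \<noteq> 0" if "0 < r" for r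
    using that assms by (auto simp: min_def max_def)
  show ?thesis
    unfolding eq[abs_def] pressure_def
    using assms pos by (cases "\<theta> = 0") (auto intro!: continuous_intros)
qed

text \<open>Under the root the first factor tends to \<open>1 / \<rho>0 > 0\<close>, while the
  pressure grows at least linearly because its exponent is at least 1.\<close>

lemma filterlim_wave_curve_at_top:
  assumes "0 \<le> \<theta>" "0 < \<rho>0"
  shows "filterlim (wave_curve \<theta> \<rho>0) at_top at_top"
proof -
  have p: "filterlim (\<lambda>r. pressure \<theta> r) at_top at_top"
  proof (rule filterlim_at_top_mono)
    show "filterlim (\<lambda>r. r * (1 / (2 * \<theta> + 1))) at_top at_top"
      by (rule filterlim_at_top_mult_tendsto_pos[OF tendsto_const _ filterlim_ident])
         (use assms in auto)
    show "\<forall>\<^sub>F r in at_top. r * (1 / (2 * \<theta> + 1)) \<le> pressure \<theta> r"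
      using eventually_ge_at_top[of 1]
    proof eventually_elim
      case (elim r)
      then have "r powr 1 \<le> r powr (2 * \<theta> + 1)"
        using assms by (intro powr_mono) auto
      then show ?case
        using elim assms by (simp add: pressure_def divide_right_mono)
    qed
  qed
  have "filterlim (\<lambda>r. pressure \<theta> r - pressure \<theta> \<rho>0) at_top at_top"
    using filterlim_tendsto_add_at_top[OF tendsto_const p, of "- pressure \<theta> \<rho>0"] by simp
  moreover have "((\<lambda>r. 1 / \<rho>0 - 1 / r) \<longlongrightarrow> 1 / \<rho>0 - 0) at_top"
    by (intro tendsto_intros tendsto_divide_0[OF tendsto_const]
        filterlim_at_top_imp_at_infinity filterlim_ident)
  ultimately have "filterlim (\<lambda>r. (1 / \<rho>0 - 1 / r) * (pressure \<theta> r - pressure \<theta> \<rho>0)) at_top at_top"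
    using assms by (intro filterlim_tendsto_pos_mult_at_top[where c = "1 / \<rho>0 - 0"]) auto
  then have "filterlim (\<lambda>r. sqrt ((1 / \<rho>0 - 1 / r) * (pressure \<theta> r - pressure \<theta> \<rho>0))) at_top at_top"
    by (rule filterlim_compose[OF sqrt_at_top])
  then show ?thesis
    by (rule filterlim_cong[THEN iffD1, rotated -1])
       (auto intro!: eventually_mono[OF eventually_gt_at_top[of \<rho>0]] simp: wave_curve_def)
qed

text \<open>The bound is the limit of the rarefaction branch at density 0; the shock branch is
  positive. Adding two such bounds rules out a middle state in the vacuum regime.\<close>

lemma wave_curve_lower_bound:
  assumes "0 < \<theta>" "0 < \<rho>0" "0 < r"
  shows "- (\<rho>0 powr \<theta> / \<theta>) < wave_curve \<theta> \<rho>0 r"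
proof (cases "r \<le> \<rho>0")
  case True
  then have "0 < r powr \<theta> / \<theta>" using assms by simp
  then show ?thesis
    using True assms by (simp add: wave_curve_def diff_divide_distrib)
next
  case False
  then have "0 < wave_curve \<theta> \<rho>0 r"
    using wave_curve_strict_mono[of \<theta> \<rho>0 \<rho>0 r] assms by simp
  moreover have "0 < \<rho>0 powr \<theta> / \<theta>" using assms by simp
  ultimately show ?thesis by linarith
qed

lemma tendsto_powr_diff_quotient:
  fixes r :: real
  assumes "0 < r"
  shows "((\<lambda>\<theta>. (r powr \<theta> - 1) / \<theta>) \<longlongrightarrow> ln r) (at_right 0)"
proof -
  have "((\<lambda>\<theta>. r powr \<theta>) has_real_derivative ln r) (at 0)"
    using assms by (auto intro!: derivative_eq_intros)
  then have "((\<lambda>\<theta>. (r powr \<theta> - 1) / \<theta>) \<longlongrightarrow> ln r) (at 0)"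
    using assms by (simp add: DERIV_def)
  then show ?thesis
    by (simp add: filterlim_at_split)
qed

text \<open>On the rarefaction branch, subtracting 1 from both powers gives two difference quotients
  of powers at exponent 0, whose limits are the logarithms. On the shock branch the pressure is
  continuous in \<theta>.\<close>

lemma tendsto_wave_curve:
  assumes "0 < \<rho>0" "0 < r"
  shows "((\<lambda>\<theta>. wave_curve \<theta> \<rho>0 r) \<longlongrightarrow> wave_curve 0 \<rho>0 r) (at_right 0)"
proof (cases "r \<le> \<rho>0")
  case True
  have "((\<lambda>\<theta>. (r powr \<theta> - 1) / \<theta> - (\<rho>0 powr \<theta> - 1) / \<theta>) \<longlongrightarrow> ln r - ln \<rho>0) (at_right 0)"
    using assms by (intro tendsto_diff tendsto_powr_diff_quotient)
  then show ?thesis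
    using True
    by (rule_tac filterlim_cong[THEN iffD1, rotated -1])
       (auto intro!: eventually_mono[OF eventually_at_right_less[of 0]]
         simp: wave_curve_def diff_divide_distrib)
next
  case False
  have "((\<lambda>\<theta>. sqrt ((1 / \<rho>0 - 1 / r) * (pressure \<theta> r - pressure \<theta> \<rho>0)))
      \<longlongrightarrow> sqrt ((1 / \<rho>0 - 1 / r) * (pressure 0 r - pressure 0 \<rho>0))) (at_right 0)"
    unfolding pressure_def using assms by (auto intro!: tendsto_eq_intros)
  then show ?thesis
    using False by (simp add: wave_curve_def)
qed

text \<open>Monotonicity replaces uniform convergence: by continuity of \<open>g0\<close>, pick a
  fixed \<open>a\<close> on the proper side of \<open>r0\<close> with \<open>g0 a\<close> still
  beyond \<open>y\<close>. Eventually \<open>r \<theta>\<close> is on the other side of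
  \<open>a\<close>, so \<open>g \<theta> a\<close> bounds \<open>g \<theta> (r \<theta>)\<close>,
  and pointwise convergence at \<open>a\<close> finishes.\<close>

lemma tendsto_mono_on_compose:
  fixes g :: "real \<Rightarrow> real \<Rightarrow> real"
  assumes mono: "\<forall>\<^sub>F \<theta> in F. \<forall>a b. 0 < a \<and> a \<le> b \<longrightarrow> g \<theta> a \<le> g \<theta> b"
    and lim: "\<And>a. 0 < a \<Longrightarrow> ((\<lambda>\<theta>. g \<theta> a) \<longlongrightarrow> g0 a) F"
    and cont: "isCont g0 r0" and r0: "0 < r0" and r: "(r \<longlongrightarrow> r0) F"
  shows "((\<lambda>\<theta>. g \<theta> (r \<theta>)) \<longlongrightarrow> g0 r0) F"
proof (rule order_tendstoI)
  fix y assume y: "y < g0 r0"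
  have "(g0 \<longlongrightarrow> g0 r0) (at_left r0)"
    using cont by (simp add: isCont_def filterlim_at_split)
  then have "\<forall>\<^sub>F a in at_left r0. y < g0 a"
    using y by (rule order_tendstoD)
  then have "\<forall>\<^sub>F a in at_left r0. y < g0 a \<and> a \<in> {0<..<r0}"
    using eventually_at_left_real[OF r0] by (rule eventually_conj)
  then obtain a where a: "y < g0 a" "0 < a" "a < r0"
    using eventually_happens'[OF trivial_limit_at_left_real] by fastforce
  show "\<forall>\<^sub>F \<theta> in F. y < g \<theta> (r \<theta>)"
    using mono order_tendstoD(1)[OF lim[OF a(2)] a(1)] order_tendstoD(1)[OF r a(3)]
  proof eventually_elim
    case (elim \<theta>)
    then show ?case using a(2) by (meson less_imp_le less_le_trans)
  qed
next
  fix y assume y: "g0 r0 < y"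
  have "(g0 \<longlongrightarrow> g0 r0) (at_right r0)"
    using cont by (simp add: isCont_def filterlim_at_split)
  then have "\<forall>\<^sub>F a in at_right r0. g0 a < y"
    using y by (rule order_tendstoD)
  then have "\<forall>\<^sub>F a in at_right r0. g0 a < y \<and> r0 < a"
    using eventually_at_right_less by (rule eventually_conj)
  then obtain a where a: "g0 a < y" "r0 < a"
    using eventually_happens'[OF trivial_limit_at_right_real] by fastforce
  then have "0 < a" using r0 by simp
  show "\<forall>\<^sub>F \<theta> in F. g \<theta> (r \<theta>) < y"
    using mono order_tendstoD(2)[OF lim[OF \<open>0 < a\<close>] a(1)]
      order_tendstoD(2)[OF r a(2)] order_tendstoD(1)[OF r r0]
  proof eventually_elim
    case (elim \<theta>)
    then show ?case by (meson less_imp_le le_less_trans)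
  qed
qed

section \<open>Structure of 1-waves\<close>

lemma wave_curve_eq_sqrt:
  assumes "\<rho>0 < r"
  shows "wave_curve \<theta> \<rho>0 r = sqrt ((1 / \<rho>0 - 1 / r) * (pressure \<theta> r - pressure \<theta> \<rho>0))"
  using assms by (simp add: wave_curve_def)

text \<open>The velocity inequality in the definition of a shock follows from the density
  inequality, as the curve is positive beyond \<open>fst l\<close>.\<close>

lemma shock_states_1_iff:
  assumes "0 \<le> \<theta>" "0 < fst l" "0 < fst r"
  shows "shock_states 1 \<theta> l r \<longleftrightarrow> fst l < fst r \<and> snd r = snd l - wave_curve \<theta> (fst l) (fst r)"
  using wave_curve_strict_mono[of \<theta> "fst l" "fst l" "fst r"] assms
  by (auto simp: shock_states_def case_prod_beta wave_curve_eq_sqrt)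

text \<open>Equality of the Riemann invariants is the curve equation, after taking logarithms if
  \<theta> = 0. The velocity inequality follows from the curve being negative below
  \<open>fst l\<close>.\<close>

lemma rarefaction_states_1_iff:
  assumes "0 \<le> \<theta>" "0 < fst l" "0 < fst r"
  shows "rarefaction_states 1 \<theta> l r \<longleftrightarrow> fst r < fst l \<and> snd r = snd l - wave_curve \<theta> (fst l) (fst r)"
proof -
  have "riemann_invariant 1 \<theta> r = riemann_invariant 1 \<theta> l
      \<longleftrightarrow> snd r = snd l - wave_curve \<theta> (fst l) (fst r)" if "fst r < fst l"
  proof (cases "\<theta> = 0")
    case True
    have "fst r * exp (snd r) = fst l * exp (snd l)
        \<longleftrightarrow> ln (fst r * exp (snd r)) = ln (fst l * exp (snd l))"
      using assms by (subst ln_inj_iff) auto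
    also have "\<dots> \<longleftrightarrow> snd r = snd l - (ln (fst r) - ln (fst l))"
      using assms by (auto simp: ln_mult)
    finally show ?thesis
      using True that by (simp add: riemann_invariant_def case_prod_beta wave_curve_def)
  next
    case False
    then show ?thesis
      using that by (auto simp: riemann_invariant_def case_prod_beta wave_curve_def diff_divide_distrib)
  qed
  then show ?thesis
    using wave_curve_strict_mono[of \<theta> "fst l" "fst r" "fst l"] assms
    by (auto simp: rarefaction_states_def case_prod_beta)
qed

text \<open>This puts a 1-shock to the left of the ray whose slope is the velocity of the right
  state, the ray used later to separate the two waves.\<close>

lemma shock_speed_less:
  assumes "0 < fst l" "fst l < fst r" "snd r < snd l"
  shows "shock_speed l r < snd r"
proof -
  have "fst l * snd r < fst l * snd l" using assms by simp
  then show ?thesis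
    using assms by (simp add: shock_speed_def case_prod_beta field_simps)
qed

text \<open>A canonical profile for comparison. The value \<open>r\<close> on the shock line is a
  choice. The last branch is the trivial wave, since on the wave curve equal densities force
  \<open>l = r\<close>.\<close>

definition wave_1 :: "real \<Rightarrow> state \<Rightarrow> state \<Rightarrow> real \<Rightarrow> state" where
  "wave_1 \<theta> l r \<xi> =
     (if fst l < fst r then (if \<xi> < shock_speed l r then l else r)
      else if fst r < fst l then
        (if \<xi> \<le> eigenvalue 1 \<theta> l then l else if eigenvalue 1 \<theta> r \<le> \<xi> then r
         else fan_state 1 \<theta> (riemann_invariant 1 \<theta> l) \<xi>)
      else l)"

definition shock_speeds_1 :: "state \<Rightarrow> state \<Rightarrow> real set" where
  "shock_speeds_1 l r = (if fst l < fst r then {shock_speed l r} else {})"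

text \<open>Everything about a 1-wave except its values at shocks is determined by its end states.
  The last alternative is there because a trivial wave may be located anywhere, whereas a proper
  1-wave ends strictly left of \<open>snd r\<close>: a shock by \<open>shock_speed_less\<close>, a
  fan because its right edge is \<open>snd r - fst r powr \<theta>\<close>.\<close>

lemma elementary_wave_1D:
  assumes w: "elementary_wave 1 \<theta> l r a b S V" and \<theta>: "0 \<le> \<theta>"
  shows "0 < fst l" "0 < fst r" "snd r = snd l - wave_curve \<theta> (fst l) (fst r)"
    "S = shock_speeds_1 l r" "\<xi> \<notin> S \<Longrightarrow> V \<xi> = wave_1 \<theta> l r \<xi>"
    "b < \<xi> \<Longrightarrow> V \<xi> = r" "l = r \<and> V \<xi> = r \<or> b < snd r"
  using w
proof (atomize (full), induction rule: elementary_wave.cases)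
  case (trivial V' c)
  then show ?case by (auto simp: shock_speeds_1_def wave_1_def)
next
  case (shock \<sigma> V')
  have *: "fst l < fst r \<and> snd r = snd l - wave_curve \<theta> (fst l) (fst r)"
    using shock_states_1_iff[of \<theta> l r] \<theta> shock by simp
  then have "snd r < snd l"
    using wave_curve_strict_mono[of \<theta> "fst l" "fst l" "fst r"] \<theta> shock by simp
  then have "shock_speed l r < snd r"
    using shock_speed_less[of l r] * shock by simp
  then show ?case
    using * shock by (auto simp: shock_speeds_1_def wave_1_def)
next
  case (rarefaction a' b' V')
  have *: "fst r < fst l \<and> snd r = snd l - wave_curve \<theta> (fst l) (fst r)"
    using rarefaction_states_1_iff[of \<theta> l r] \<theta> rarefaction by simp
  have "eigenvalue 1 \<theta> r < snd r"
    using rarefaction by (simp add: eigenvalue_def case_prod_beta)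
  then show ?case
    using * rarefaction by (auto simp: shock_speeds_1_def wave_1_def)
qed

lemma ex_elementary_wave_1:
  assumes "0 \<le> \<theta>" "0 < fst l" "0 < fst r" "snd r = snd l - wave_curve \<theta> (fst l) (fst r)"
  shows "\<exists>a b S V. elementary_wave 1 \<theta> l r a b S V \<and> b < snd r"
proof -
  consider "fst l = fst r" | "fst l < fst r" | "fst r < fst l" by linarith
  then show ?thesis
  proof cases
    case 1
    then have "l = r"
      using assms by (simp add: prod_eq_iff)
    \<comment> \<open>The location of the trivial wave is free; \<open>snd r - 1\<close> is merely a
      point left of \<open>snd r\<close>.\<close>
    then have "elementary_wave 1 \<theta> l r (snd r - 1) (snd r - 1) {} (\<lambda>_. l)"
      using assms by (intro elementary_wave.trivial) auto
    then show ?thesis by force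
  next
    case 2
    let ?\<sigma> = "shock_speed l r"
    have "shock_states 1 \<theta> l r"
      using shock_states_1_iff[of \<theta> l r] assms 2
      by (simp del: One_nat_def)
    then have *: "elementary_wave 1 \<theta> l r ?\<sigma> ?\<sigma> {?\<sigma>} (\<lambda>\<xi>. if \<xi> < ?\<sigma> then l else r)"
      using assms by (intro elementary_wave.shock) auto
    then show ?thesis
      using elementary_wave_1D(7)[OF *] assms 2 by blast
  next
    case 3
    have r: "rarefaction_states 1 \<theta> l r"
      using rarefaction_states_1_iff[of \<theta> l r] assms 3 by simp
    have "snd l < snd r" "fst r powr \<theta> \<le> fst l powr \<theta>"
      using wave_curve_strict_mono[of \<theta> "fst l" "fst r" "fst l"] assms 3
      by (auto intro!: powr_mono2)
    then have le: "eigenvalue 1 \<theta> l < eigenvalue 1 \<theta> r"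
      by (simp add: eigenvalue_def case_prod_beta)
    have *: "elementary_wave 1 \<theta> l r (eigenvalue 1 \<theta> l) (eigenvalue 1 \<theta> r) {} (wave_1 \<theta> l r)"
      using assms r 3 le by (intro elementary_wave.rarefaction) (auto simp: wave_1_def)
    then show ?thesis
      using elementary_wave_1D(7)[OF *] assms 3 by blast
  qed
qed

section \<open>Reflection symmetry between 1-waves and 2-waves\<close>

text \<open>Reflection \<open>x \<mapsto> - x\<close>, \<open>u \<mapsto> - u\<close> exchanges 1-waves and 2-waves, so that only 1-waves have to be
  analysed.\<close>

definition mirror :: "state \<Rightarrow> state" where
  "mirror = (\<lambda>(\<rho>, u). (\<rho>, - u))"

lemma fst_mirror [simp]: "fst (mirror s) = fst s"
  and snd_mirror [simp]: "snd (mirror s) = - snd s"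
  and mirror_mirror [simp]: "mirror (mirror s) = s"
  by (auto simp: mirror_def case_prod_beta)

lemma mirror_eq_iff [simp]: "mirror s = mirror t \<longleftrightarrow> s = t"
  by (metis mirror_mirror)

text \<open>Reflection swaps the end states, negates speeds and eigenvalues, and exchanges the
  families. Riemann invariants change sign for \<theta> > 0 but are preserved for \<theta> = 0,
  where the sign of the velocity is absorbed by the exponent; hence the conditionals in
  \<open>ri\<close> and \<open>fan\<close>.\<close>

lemma elementary_wave_mirror:
  assumes ij: "i = 1 \<and> j = 2 \<or> i = 2 \<and> j = 1" and w: "elementary_wave j \<theta> l r a b S V"
  shows "elementary_wave i \<theta> (mirror r) (mirror l) (- b) (- a) (uminus ` S) (\<lambda>\<xi>. mirror (V (- \<xi>)))"
  using w
proof cases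
  case trivial
  have "elementary_wave i \<theta> (mirror l) (mirror l) (- a) (- a) {} (\<lambda>\<xi>. mirror (V (- \<xi>)))"
    by (rule elementary_wave.trivial) (use trivial in auto)
  then show ?thesis
    using trivial by simp
next
  case shock
  have "(\<rho>r * ur - \<rho>l * ul) / (\<rho>r - \<rho>l) = - ((\<rho>l * - ul - \<rho>r * - ur) / (\<rho>l - \<rho>r))" for \<rho>r ur \<rho>l ul :: real
    by (cases "\<rho>l = \<rho>r") (auto simp: divide_simps, simp add: algebra_simps)
  then have sp: "- a = shock_speed (mirror r) (mirror l)"
    unfolding shock(6) shock_speed_def mirror_def by (simp add: case_prod_beta)
  have "(1 / x - 1 / y) * (p - q) = (1 / y - 1 / x) * (q - p)" for x y p q :: real
    using minus_mult_minus[of "1 / x - 1 / y" "p - q"] by simp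
  then have st: "shock_states i \<theta> (mirror r) (mirror l)"
    using shock(5) ij by (auto simp: shock_states_def mirror_def case_prod_beta)
  have "elementary_wave i \<theta> (mirror r) (mirror l) (- a) (- a) {- a} (\<lambda>\<xi>. mirror (V (- \<xi>)))"
    by (rule elementary_wave.shock[OF _ _ st sp]) (use shock in auto)
  then show ?thesis
    using shock by simp
next
  case rarefaction
  have sgn: "(-1) ^ i = - ((-1) ^ j :: real)"
    using ij by auto
  have ev: "eigenvalue i \<theta> (mirror s) = - eigenvalue j \<theta> s" for s
    by (simp add: eigenvalue_def mirror_def case_prod_beta sgn)
  have ri: "riemann_invariant i \<theta> (mirror s) =
      (if \<theta> = 0 then riemann_invariant j \<theta> s else - riemann_invariant j \<theta> s)" for s
    by (simp add: riemann_invariant_def mirror_def case_prod_beta sgn)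
  have fan: "fan_state i \<theta> (if \<theta> = 0 then w else - w) (- \<xi>) = mirror (fan_state j \<theta> w \<xi>)" for w \<xi>
  proof -
    have "(- s) * \<theta> * (- \<xi> - - w) / (\<theta> + 1) = s * \<theta> * (\<xi> - w) / (\<theta> + 1)" for s
      by (simp add: algebra_simps)
    moreover have "(- \<xi> + \<theta> * - w) / (\<theta> + 1) = - ((\<xi> + \<theta> * w) / (\<theta> + 1))"
      unfolding minus_divide_left by simp
    ultimately show ?thesis
      unfolding fan_state_def mirror_def sgn by (simp only: split: if_split) simp
  qed
  have inv: "riemann_invariant j \<theta> r = riemann_invariant j \<theta> l"
    using rarefaction(4) by (auto simp: rarefaction_states_def case_prod_beta)
  have st: "rarefaction_states i \<theta> (mirror r) (mirror l)"
    using rarefaction(4) ij inv ri[of l] ri[of r]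
    by (auto simp: rarefaction_states_def mirror_def case_prod_beta)
  have "elementary_wave i \<theta> (mirror r) (mirror l) (- b) (- a) {} (\<lambda>\<xi>. mirror (V (- \<xi>)))"
  proof (rule elementary_wave.rarefaction[OF _ _ st])
    show "\<forall>\<xi>. - b < \<xi> \<and> \<xi> < - a \<longrightarrow>
        mirror (V (- \<xi>)) = fan_state i \<theta> (riemann_invariant i \<theta> (mirror r)) \<xi>"
    proof (intro allI impI)
      fix \<xi> assume "- b < \<xi> \<and> \<xi> < - a"
      then have "V (- \<xi>) = fan_state j \<theta> (riemann_invariant j \<theta> l) (- \<xi>)"
        using rarefaction(9) by auto
      then show "mirror (V (- \<xi>)) = fan_state i \<theta> (riemann_invariant i \<theta> (mirror r)) \<xi>"
        using fan[of "riemann_invariant j \<theta> l" "- \<xi>"] by (simp only: ri inv minus_minus)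
    qed
  qed (use rarefaction ev in auto)
  then show ?thesis
    using rarefaction by simp
qed

section \<open>Middle states and non-vacuum profiles\<close>

definition intermediate_state :: "real \<Rightarrow> state \<Rightarrow> state \<Rightarrow> state \<Rightarrow> bool" where
  "intermediate_state \<theta> L R M \<longleftrightarrow> 0 < fst M \<and>
     snd M = snd L - wave_curve \<theta> (fst L) (fst M) \<and>
     snd M = snd R + wave_curve \<theta> (fst R) (fst M)"

definition solution_speeds :: "state \<Rightarrow> state \<Rightarrow> state \<Rightarrow> real set" where
  "solution_speeds L R M = shock_speeds_1 L M \<union> uminus ` shock_speeds_1 (mirror R) (mirror M)"

text \<open>Proper 1-waves end left of \<open>snd M\<close> and proper 2-waves start right of it.
  Cutting there gives a profile that depends on \<open>M\<close> alone, and not on where trivial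
  waves are placed.\<close>

definition solution_profile :: "real \<Rightarrow> state \<Rightarrow> state \<Rightarrow> state \<Rightarrow> real \<Rightarrow> state" where
  "solution_profile \<theta> L R M \<xi> =
     (if \<xi> \<le> snd M then wave_1 \<theta> L M \<xi> else mirror (wave_1 \<theta> (mirror R) (mirror M) (- \<xi>)))"

lemma nonvacuum_profileD:
  assumes "nonvacuum_profile \<theta> L R S V" "0 \<le> \<theta>"
  obtains M where "intermediate_state \<theta> L R M" "S = solution_speeds L R M"
    "\<And>\<xi>. \<xi> \<notin> S \<Longrightarrow> V \<xi> = solution_profile \<theta> L R M \<xi>"
proof -
  obtain M a1 b1 S1 V1 a2 b2 S2 V2 where M: "0 < fst M"
    and w1: "elementary_wave 1 \<theta> L M a1 b1 S1 V1" and w2: "elementary_wave 2 \<theta> M R a2 b2 S2 V2"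
    and V: "b1 < a2" "S = S1 \<union> S2" "\<forall>\<xi> \<le> b1. V \<xi> = V1 \<xi>"
      "\<forall>\<xi>. b1 < \<xi> \<and> \<xi> < a2 \<longrightarrow> V \<xi> = M" "\<forall>\<xi> \<ge> a2. V \<xi> = V2 \<xi>"
    using assms(1) unfolding nonvacuum_profile_def by (elim exE conjE) (rule that)
  have m2: "elementary_wave 1 \<theta> (mirror R) (mirror M) (- b2) (- a2) (uminus ` S2) (\<lambda>\<xi>. mirror (V2 (- \<xi>)))"
    by (rule elementary_wave_mirror[OF _ w2]) simp
  note d1 = elementary_wave_1D[OF w1 assms(2)] and d2 = elementary_wave_1D[OF m2 assms(2)]
  have S2: "S2 = uminus ` shock_speeds_1 (mirror R) (mirror M)"
    using arg_cong[OF d2(4), of "image uminus"] by (simp add: image_image)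
  have V2: "V2 \<xi> = mirror (wave_1 \<theta> (mirror R) (mirror M) (- \<xi>))" if "\<xi> \<notin> S2" for \<xi>
  proof -
    have "- \<xi> \<notin> uminus ` S2"
      using that by auto
    then show ?thesis
      using arg_cong[OF d2(5), of "- \<xi>" mirror] by simp
  qed
  have V2': "V2 \<xi> = M" if "\<xi> < a2" for \<xi>
    using d2(6)[of "- \<xi>"] that by simp
  have V2'': "V2 \<xi> = M \<or> snd M < a2" for \<xi>
    using d2(7)[of "- \<xi>"] by auto
  have "V \<xi> = solution_profile \<theta> L R M \<xi>" if "\<xi> \<notin> S" for \<xi>
  proof (cases "\<xi> \<le> snd M")
    case True
    \<comment> \<open>Left of \<open>snd M\<close> the 2-wave can only have begun if it is trivial,
      and then its value is \<open>M\<close>, which is also the value of \<open>V1\<close> beyond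
      \<open>b1\<close>.\<close>
    have "V \<xi> = V1 \<xi>"
    proof -
      consider "\<xi> \<le> b1" | "b1 < \<xi>" "\<xi> < a2" | "b1 < \<xi>" "a2 \<le> \<xi>" by linarith
      then show ?thesis
        using V(3-5) V2''[of \<xi>] d1(6)[of \<xi>] True by cases auto
    qed
    then show ?thesis
      using d1(5)[of \<xi>] True V(2) that by (simp add: solution_profile_def)
  next
    case False
    have "V \<xi> = V2 \<xi>"
    proof -
      consider "a2 \<le> \<xi>" | "\<xi> < a2" "b1 < \<xi>" | "\<xi> < a2" "\<xi> \<le> b1" by linarith
      then show ?thesis
        using V(3-5) V2'[of \<xi>] d1(7)[of \<xi>] False by cases auto
    qed
    then show ?thesis
      using V2[of \<xi>] False V(2) that by (simp add: solution_profile_def)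
  qed
  moreover have "intermediate_state \<theta> L R M"
    using M d1(3) d2(3) by (simp add: intermediate_state_def)
  ultimately show ?thesis
    using that V(2) d1(4) S2 by (simp add: solution_speeds_def)
qed

text \<open>The 1-wave ends left of \<open>snd M\<close>; the mirror image of a 1-wave starting from
  \<open>mirror R\<close> supplies a 2-wave beginning right of it, so the waves do not
  overlap.\<close>

lemma ex_nonvacuum_profile:
  assumes "intermediate_state \<theta> L R M" "0 \<le> \<theta>" "0 < fst L" "0 < fst R"
  shows "\<exists>S V. nonvacuum_profile \<theta> L R S V"
proof -
  have M: "0 < fst M" "snd M = snd L - wave_curve \<theta> (fst L) (fst M)"
    "snd (mirror M) = snd (mirror R) - wave_curve \<theta> (fst (mirror R)) (fst (mirror M))"
    using assms(1) by (auto simp: intermediate_state_def)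
  obtain a1 b1 S1 V1 where 1: "elementary_wave 1 \<theta> L M a1 b1 S1 V1" "b1 < snd M"
    using ex_elementary_wave_1[OF assms(2,3) M(1,2)] by blast
  obtain a2 b2 S2 V2 where 2: "elementary_wave 1 \<theta> (mirror R) (mirror M) a2 b2 S2 V2" "b2 < - snd M"
    using ex_elementary_wave_1[OF assms(2) _ _ M(3)] M(1) assms(4) by auto
  have w2: "elementary_wave 2 \<theta> M R (- b2) (- a2) (uminus ` S2) (\<lambda>\<xi>. mirror (V2 (- \<xi>)))"
    using elementary_wave_mirror[OF _ 2(1), of 2] by simp
  have lt: "b1 < - b2" using 1 2 by simp
  let ?V = "\<lambda>\<xi>. if \<xi> \<le> b1 then V1 \<xi> else if \<xi> < - b2 then M else mirror (V2 (- \<xi>))"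
  have "nonvacuum_profile \<theta> L R (S1 \<union> uminus ` S2) ?V"
    unfolding nonvacuum_profile_def
    by (rule exI[of _ M], rule exI[of _ a1], rule exI[of _ b1], rule exI[of _ S1],
        rule exI[of _ V1], rule exI[of _ "- b2"], rule exI[of _ "- a2"],
        rule exI[of _ "uminus ` S2"], rule exI[of _ "\<lambda>\<xi>. mirror (V2 (- \<xi>))"])
       (use lt M(1) 1(1) w2 in auto)
  then show ?thesis by blast
qed

text \<open>Eliminating the velocity, the sum of the two wave curves equals
  \<open>snd L - snd R\<close> at both densities, and this sum is strictly increasing.\<close>

lemma intermediate_state_unique:
  assumes "intermediate_state \<theta> L R M" "intermediate_state \<theta> L R M'" "0 \<le> \<theta>" "0 < fst L" "0 < fst R"
  shows "M = M'"
proof -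
  have "\<not> r < s" if "0 < r" "wave_curve \<theta> (fst L) r + wave_curve \<theta> (fst R) r
      = wave_curve \<theta> (fst L) s + wave_curve \<theta> (fst R) s" for r s
    using wave_curve_strict_mono[of \<theta> "fst L" r s] wave_curve_strict_mono[of \<theta> "fst R" r s] that assms
    by force
  from this[of "fst M" "fst M'"] this[of "fst M'" "fst M"] have "fst M = fst M'"
    using assms(1,2) unfolding intermediate_state_def by force
  then show ?thesis
    using assms(1,2) by (simp add: intermediate_state_def prod_eq_iff)
qed

lemma intermediate_state_no_vacuum:
  assumes "intermediate_state \<theta> L R M" "0 < \<theta>" "0 < fst L" "0 < fst R"
  shows "riemann_invariant 2 \<theta> R < riemann_invariant 1 \<theta> L"
  using wave_curve_lower_bound[of \<theta> "fst L" "fst M"] wave_curve_lower_bound[of \<theta> "fst R" "fst M"] assms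
  by (simp add: intermediate_state_def riemann_invariant_def case_prod_beta)

text \<open>Intermediate value theorem for the sum of the two curves. It is unbounded above. Near
  density 0 it tends to minus infinity if \<theta> = 0, and otherwise to a limit that lies below
  \<open>snd L - snd R\<close> exactly by the hypothesis on the invariants.\<close>

lemma ex_intermediate_state:
  assumes "0 \<le> \<theta>" "0 < fst L" "0 < fst R"
    and "\<theta> = 0 \<or> riemann_invariant 2 \<theta> R < riemann_invariant 1 \<theta> L"
  shows "\<exists>M. intermediate_state \<theta> L R M"
proof -
  let ?F = "\<lambda>r. wave_curve \<theta> (fst L) r + wave_curve \<theta> (fst R) r" and ?c = "snd L - snd R"
  have wc: "\<forall>\<^sub>F r in at_right 0. wave_curve \<theta> \<rho>0 r =
      (if \<theta> = 0 then ln r - ln \<rho>0 else (r powr \<theta> - \<rho>0 powr \<theta>) / \<theta>)" if "0 < \<rho>0" for \<rho>0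
    using eventually_at_right_real[OF that] by eventually_elim (auto simp: wave_curve_def)
  have ev: "\<forall>\<^sub>F r in at_right 0. ?F r \<le> ?c"
  proof (cases "\<theta> = 0")
    case True
    have "filterlim (\<lambda>r::real. 2 * ln r) at_bot (at_right 0)"
      by (rule filterlim_tendsto_pos_mult_at_bot[OF tendsto_const _ ln_at_0]) simp
    then have "\<forall>\<^sub>F r in at_right 0. 2 * ln r \<le> ?c + ln (fst L) + ln (fst R)"
      by (simp add: filterlim_at_bot)
    then show ?thesis
      using wc[OF assms(2)] wc[OF assms(3)] by eventually_elim (simp add: True)
  next
    case False
    have "((\<lambda>r. (r powr \<theta> - fst L powr \<theta>) / \<theta> + (r powr \<theta> - fst R powr \<theta>) / \<theta>)
        \<longlongrightarrow> (0 powr \<theta> - fst L powr \<theta>) / \<theta> + (0 powr \<theta> - fst R powr \<theta>) / \<theta>) (at_right 0)"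
      using False assms(1)
      by (intro tendsto_intros tendsto_powr')
         (auto intro: eventually_mono[OF eventually_at_right_less[of "0::real"]])
    then have "\<forall>\<^sub>F r in at_right 0.
        (r powr \<theta> - fst L powr \<theta>) / \<theta> + (r powr \<theta> - fst R powr \<theta>) / \<theta> < ?c"
      by (rule order_tendstoD)
         (use False assms in \<open>simp add: riemann_invariant_def case_prod_beta diff_divide_distrib\<close>)
    then show ?thesis
      using wc[OF assms(2)] wc[OF assms(3)] by eventually_elim (simp add: False)
  qed
  obtain a where a: "0 < a" "?F a \<le> ?c"
    using eventually_happens'[OF trivial_limit_at_right_real
        eventually_conj[OF ev eventually_at_right_less[of 0]]] by auto
  have "filterlim ?F at_top at_top"
    using assms by (intro filterlim_at_top_add_at_top filterlim_wave_curve_at_top) auto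
  then have "\<forall>\<^sub>F r in at_top. ?c \<le> ?F r"
    by (simp add: filterlim_at_top)
  then obtain b where b: "a \<le> b" "?c \<le> ?F b"
    using eventually_happens'[OF trivial_limit_at_top_linorder
        eventually_conj[OF _ eventually_ge_at_top[of a]]] by blast
  have "continuous_on {a..b} ?F"
    using a assms
    by (intro continuous_on_add continuous_on_subset[OF continuous_on_wave_curve]) auto
  then obtain r where "a \<le> r" "?F r = ?c"
    using IVT'[OF a(2) b(2,1)] by auto
  then show ?thesis
    using a by (intro exI[of _ "(r, snd L - wave_curve \<theta> (fst L) r)"])
      (auto simp: intermediate_state_def)
qed

section \<open>Existence and uniqueness of the Riemann solution\<close>

lemma riemann_solutionE:
  assumes "riemann_solution \<theta> L R S \<rho> u"
  obtains V where "nonvacuum_profile \<theta> L R S V \<or> S = {} \<and> vacuum_profile \<theta> L R V"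
    "\<And>t x. 0 < t \<Longrightarrow> \<rho> t x = fst (V (x / t))" "\<And>t x. 0 < t \<Longrightarrow> u t x = snd (V (x / t))"
proof -
  obtain V where V: "nonvacuum_profile \<theta> L R S V \<or> S = {} \<and> vacuum_profile \<theta> L R V"
    "\<forall>t > 0. \<forall>x. (\<rho> t x, u t x) = V (x / t)"
    using assms unfolding riemann_solution_def by (elim exE conjE) (rule that)
  show thesis
  proof (rule that[OF V(1)])
    fix t x :: real assume "0 < t"
    then have "V (x / t) = (\<rho> t x, u t x)"
      using V(2) by simp
    then show "\<rho> t x = fst (V (x / t))" "u t x = snd (V (x / t))"
      by simp_all
  qed
qed

text \<open>The order of the two invariants decides the type. If a middle state exists, the vacuum
  condition fails and every solution has the canonical profile of that state; otherwise every
  solution is the explicit vacuum profile, up to the velocity in the vacuum.\<close>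

lemma ex1_riemann_solution:
  assumes "0 \<le> \<theta>" "0 < fst L" "0 < fst R"
  shows "\<exists>S \<rho> u. riemann_solution \<theta> L R S \<rho> u \<and>
      (\<forall>S' \<rho>' u'. riemann_solution \<theta> L R S' \<rho>' u' \<longrightarrow>
         S' = S \<and>
         (\<forall>t>0. \<forall>x. x / t \<notin> S \<longrightarrow>
            \<rho>' t x = \<rho> t x \<and> (0 < \<rho> t x \<longrightarrow> u' t x = u t x)))"
proof (cases "\<theta> = 0 \<or> riemann_invariant 2 \<theta> R < riemann_invariant 1 \<theta> L")
  case True
  obtain M where M: "intermediate_state \<theta> L R M"
    using ex_intermediate_state[OF assms True] by blast
  have char: "S = solution_speeds L R M \<and> (\<forall>\<xi>. \<xi> \<notin> S \<longrightarrow> V \<xi> = solution_profile \<theta> L R M \<xi>)"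
    if V: "nonvacuum_profile \<theta> L R S V \<or> S = {} \<and> vacuum_profile \<theta> L R V" for S V
  proof -
    have "nonvacuum_profile \<theta> L R S V"
      using V True by (auto simp: vacuum_profile_def Let_def)
    then show ?thesis
      by (rule nonvacuum_profileD[OF _ assms(1)])
        (use intermediate_state_unique[OF M _ assms] in blast)
  qed
  obtain S V where V: "nonvacuum_profile \<theta> L R S V"
    using ex_nonvacuum_profile[OF M assms] by blast
  have sol: "riemann_solution \<theta> L R S (\<lambda>t x. fst (V (x / t))) (\<lambda>t x. snd (V (x / t)))"
    unfolding riemann_solution_def using V by auto
  have unique: "S' = S \<and> (\<forall>t>0. \<forall>x. x / t \<notin> S \<longrightarrow>
      \<rho>' t x = fst (V (x / t)) \<and> u' t x = snd (V (x / t)))"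
    if sol': "riemann_solution \<theta> L R S' \<rho>' u'" for S' \<rho>' u'
  proof -
    obtain V' where V': "nonvacuum_profile \<theta> L R S' V' \<or> S' = {} \<and> vacuum_profile \<theta> L R V'"
      "\<And>t x. 0 < t \<Longrightarrow> \<rho>' t x = fst (V' (x / t))" "\<And>t x. 0 < t \<Longrightarrow> u' t x = snd (V' (x / t))"
      using riemann_solutionE[OF sol'] by metis
    show ?thesis
      using char[of S V] V char[OF V'(1)] V'(2,3) by simp
  qed
  show ?thesis
    by (rule exI[of _ S], rule exI[of _ "\<lambda>t x. fst (V (x / t))"],
        rule exI[of _ "\<lambda>t x. snd (V (x / t))"])
       (use sol unique in blast)
next
  case False
  then have \<theta>: "0 < \<theta>" and le: "riemann_invariant 1 \<theta> L \<le> riemann_invariant 2 \<theta> R"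
    using assms(1) by auto
  \<comment> \<open>This quantity is the width of the fan between a state and the vacuum, so the
    pieces of \<open>?V\<close> below are correctly ordered.\<close>
  have "0 < fst s powr \<theta> + fst s powr \<theta> / \<theta>" if "0 < fst s" for s :: state
    using \<theta> that by (intro add_pos_pos) auto
  from this[OF assms(2)] this[OF assms(3)]
  have lt: "eigenvalue 1 \<theta> L < riemann_invariant 1 \<theta> L" "riemann_invariant 2 \<theta> R < eigenvalue 2 \<theta> R"
    using False by (simp_all add: eigenvalue_def riemann_invariant_def case_prod_beta; linarith)+
  \<comment> \<open>The velocity 0 in the vacuum is an arbitrary choice.\<close>
  let ?V = "\<lambda>\<xi>. if \<xi> \<le> eigenvalue 1 \<theta> L then L
    else if \<xi> < riemann_invariant 1 \<theta> L then fan_state 1 \<theta> (riemann_invariant 1 \<theta> L) \<xi>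
    else if \<xi> \<le> riemann_invariant 2 \<theta> R then (0, 0)
    else if \<xi> < eigenvalue 2 \<theta> R then fan_state 2 \<theta> (riemann_invariant 2 \<theta> R) \<xi> else R"
  have V: "vacuum_profile \<theta> L R ?V"
    unfolding vacuum_profile_def Let_def using \<theta> le lt by (intro conjI) auto
  have sol: "riemann_solution \<theta> L R {} (\<lambda>t x. fst (?V (x / t))) (\<lambda>t x. snd (?V (x / t)))"
    unfolding riemann_solution_def by (rule exI[of _ ?V]) (use V in simp)
  have unique: "S' = {} \<and> (\<forall>t>0. \<forall>x. \<rho>' t x = fst (?V (x / t)) \<and>
      (0 < fst (?V (x / t)) \<longrightarrow> u' t x = snd (?V (x / t))))"
    if sol': "riemann_solution \<theta> L R S' \<rho>' u'" for S' \<rho>' u'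
  proof -
    obtain V' where V': "nonvacuum_profile \<theta> L R S' V' \<or> S' = {} \<and> vacuum_profile \<theta> L R V'"
      "\<And>t x. 0 < t \<Longrightarrow> \<rho>' t x = fst (V' (x / t))" "\<And>t x. 0 < t \<Longrightarrow> u' t x = snd (V' (x / t))"
      using riemann_solutionE[OF sol'] by metis
    have "\<not> nonvacuum_profile \<theta> L R S' V'"
    proof
      assume "nonvacuum_profile \<theta> L R S' V'"
      then obtain M where "intermediate_state \<theta> L R M"
        using assms(1) by (rule nonvacuum_profileD)
      then show False
        using intermediate_state_no_vacuum[OF _ \<theta> assms(2,3)] le by fastforce
    qed
    then have S': "S' = {}" and vac: "vacuum_profile \<theta> L R V'"
      using V'(1) by auto
    have eq: "fst (V' \<xi>) = fst (?V \<xi>) \<and> (0 < fst (?V \<xi>) \<longrightarrow> V' \<xi> = ?V \<xi>)" for \<xi>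
      using vac unfolding vacuum_profile_def Let_def by auto
    show ?thesis
    proof (intro conjI[OF S'] conjI allI impI)
      fix t x :: real assume t: "0 < t"
      show "\<rho>' t x = fst (?V (x / t))"
        unfolding V'(2)[OF t] using eq[of "x / t"] by (rule conjunct1)
      assume "0 < fst (?V (x / t))"
      then show "u' t x = snd (?V (x / t))"
        unfolding V'(3)[OF t] by (intro arg_cong[of _ _ snd] eq[THEN conjunct2, rule_format])
    qed
  qed
  show ?thesis
    by (rule exI[of _ "{}"], rule exI[of _ "\<lambda>t x. fst (?V (x / t))"],
        rule exI[of _ "\<lambda>t x. snd (?V (x / t))"])
       (use sol unique in blast)
qed

section \<open>Convergence of a single 1-wave\<close>

text \<open>The fan density has the form \<open>B \<theta> powr (1 / \<theta>)\<close> with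
  \<open>B 0 = 1\<close>. Its logarithm is the difference quotient of \<open>ln (B \<theta>)\<close>
  at 0, so the limit is the exponential of a derivative, which is the isothermal fan.\<close>

lemma tendsto_fan_state_1:
  assumes "0 < fst l"
  shows "((\<lambda>\<theta>. fan_state 1 \<theta> (riemann_invariant 1 \<theta> l) \<xi>)
    \<longlongrightarrow> fan_state 1 0 (riemann_invariant 1 0 l) \<xi>) (at_right 0)"
proof -
  \<comment> \<open>Inserting the invariant of \<open>l\<close> into the base of the fan density
    cancels the division by \<theta>, so \<open>B\<close> is differentiable at 0.\<close>
  define B where "B \<theta> = (fst l powr \<theta> + \<theta> * (snd l - \<xi>)) / (\<theta> + 1)" for \<theta>
  have "(B has_real_derivative ln (fst l) + (snd l - \<xi>) - 1) (at 0)"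
    unfolding B_def[abs_def] using assms by (auto intro!: derivative_eq_intros)
  moreover have B0: "B 0 = 1"
    using assms by (simp add: B_def)
  ultimately have "((\<lambda>\<theta>. ln (B \<theta>)) has_real_derivative ln (fst l) + (snd l - \<xi>) - 1) (at 0)"
    by (auto intro!: derivative_eq_intros)
  then have "((\<lambda>\<theta>. ln (B \<theta>) / \<theta>) \<longlongrightarrow> ln (fst l) + (snd l - \<xi>) - 1) (at_right 0)"
    by (simp add: DERIV_def B0 filterlim_at_split)
  then have "((\<lambda>\<theta>. exp (ln (B \<theta>) / \<theta>)) \<longlongrightarrow> exp (ln (fst l) + (snd l - \<xi>) - 1)) (at_right 0)"
    by (rule tendsto_exp)
  moreover have "exp (ln (fst l) + (snd l - \<xi>) - 1) = fst (fan_state 1 0 (riemann_invariant 1 0 l) \<xi>)"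
    using assms by (simp add: fan_state_def riemann_invariant_def case_prod_beta exp_add exp_diff exp_minus field_simps)
  moreover have "\<forall>\<^sub>F \<theta> in at_right 0.
      exp (ln (B \<theta>) / \<theta>) = fst (fan_state 1 \<theta> (riemann_invariant 1 \<theta> l) \<xi>)"
  proof -
    have "(B \<longlongrightarrow> B 0) (at_right 0)"
      unfolding B_def[abs_def] using assms by (auto intro!: tendsto_eq_intros)
    then have "\<forall>\<^sub>F \<theta> in at_right 0. 0 < B \<theta>"
      by (rule order_tendstoD) (simp add: B0)
    then show ?thesis
      using eventually_at_right_less
    proof eventually_elim
      case (elim \<theta>)
      then have "- 1 * \<theta> * (\<xi> - (snd l + fst l powr \<theta> / \<theta>)) = fst l powr \<theta> + \<theta> * (snd l - \<xi>)"
        by (simp add: field_simps)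
      then have "- 1 * \<theta> * (\<xi> - (snd l + fst l powr \<theta> / \<theta>)) / (\<theta> + 1) = B \<theta>"
        by (simp only: B_def)
      then show ?case
        using elim by (simp add: fan_state_def riemann_invariant_def case_prod_beta powr_def)
    qed
  qed
  ultimately have 1: "((\<lambda>\<theta>. fst (fan_state 1 \<theta> (riemann_invariant 1 \<theta> l) \<xi>))
      \<longlongrightarrow> fst (fan_state 1 0 (riemann_invariant 1 0 l) \<xi>)) (at_right 0)"
    using Lim_transform_eventually by simp
  have "((\<lambda>\<theta>. (\<xi> + \<theta> * snd l + fst l powr \<theta>) / (\<theta> + 1)) \<longlongrightarrow> \<xi> + 1) (at_right 0)"
    using assms by (auto intro!: tendsto_eq_intros)
  moreover have "\<forall>\<^sub>F \<theta> in at_right 0. (\<xi> + \<theta> * snd l + fst l powr \<theta>) / (\<theta> + 1)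
      = snd (fan_state 1 \<theta> (riemann_invariant 1 \<theta> l) \<xi>)"
    using eventually_at_right_less
    by eventually_elim
       (simp add: fan_state_def riemann_invariant_def case_prod_beta distrib_left add.assoc)
  ultimately have "((\<lambda>\<theta>. snd (fan_state 1 \<theta> (riemann_invariant 1 \<theta> l) \<xi>)) \<longlongrightarrow> \<xi> + 1) (at_right 0)"
    by (rule Lim_transform_eventually)
  then have 2: "((\<lambda>\<theta>. snd (fan_state 1 \<theta> (riemann_invariant 1 \<theta> l) \<xi>))
      \<longlongrightarrow> snd (fan_state 1 0 (riemann_invariant 1 0 l) \<xi>)) (at_right 0)"
    by (simp add: fan_state_def)
  show ?thesis
    using tendsto_Pair[OF 1 2] by simp
qed

text \<open>By the mean value theorem the shock speed is \<open>u\<^sub>l - sqrt (\<rho>\<^sub>r / \<rho>\<^sub>l * z powr (2 * \<theta>))\<close> for some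
  \<open>z\<close> between the densities. In contrast to the defining quotient, these bounds stay meaningful when the
  shock strength tends to 0.\<close>

lemma shock_speed_bounds:
  assumes "0 \<le> \<theta>" "0 < fst l" "fst l < fst r" "snd r = snd l - wave_curve \<theta> (fst l) (fst r)"
  shows "snd l - sqrt (fst r / fst l * fst r powr (2 * \<theta>)) \<le> shock_speed l r"
    "shock_speed l r \<le> snd l - sqrt (fst r / fst l * fst l powr (2 * \<theta>))"
proof -
  let ?a = "fst l" and ?b = "fst r"
  have "(pressure \<theta> has_real_derivative x powr (2 * \<theta>)) (at x)" if "?a \<le> x" for x
    unfolding pressure_def[abs_def] using that assms
    by (auto intro!: derivative_eq_intros simp: add.commute)
  then obtain z where z: "?a < z" "z < ?b"
    "pressure \<theta> ?b - pressure \<theta> ?a = (?b - ?a) * z powr (2 * \<theta>)"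
    using MVT2[OF assms(3), of "pressure \<theta>" "\<lambda>x. x powr (2 * \<theta>)"] by auto
  have "wave_curve \<theta> ?a ?b = sqrt ((1 / ?a - 1 / ?b) * ((?b - ?a) * z powr (2 * \<theta>)))"
    using assms(3) z(3) by (simp add: wave_curve_eq_sqrt)
  \<comment> \<open>Splitting off a perfect square lets the factor \<open>?b - ?a\<close> leave the
    root and cancel the denominator of the shock speed.\<close>
  also have "(1 / ?a - 1 / ?b) * ((?b - ?a) * z powr (2 * \<theta>))
      = ((?b - ?a) / ?b)\<^sup>2 * (?b / ?a * z powr (2 * \<theta>))"
    using assms by (simp add: field_simps power2_eq_square)
  also have "sqrt \<dots> = (?b - ?a) / ?b * sqrt (?b / ?a * z powr (2 * \<theta>))"
    using assms by (simp only: real_sqrt_mult real_sqrt_abs) simp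
  finally have wc: "wave_curve \<theta> ?a ?b = (?b - ?a) / ?b * sqrt (?b / ?a * z powr (2 * \<theta>))" .
  have "(?b * (v - w) - ?a * v) / (?b - ?a) = v - ?b * w / (?b - ?a)" for v w
    using assms(3) by (simp add: field_simps)
  then have "shock_speed l r = snd l - ?b * wave_curve \<theta> ?a ?b / (?b - ?a)"
    by (simp add: shock_speed_def case_prod_beta assms(4))
  also have "\<dots> = snd l - sqrt (?b / ?a * z powr (2 * \<theta>))"
    unfolding wc using assms by simp
  finally have s: "shock_speed l r = snd l - sqrt (?b / ?a * z powr (2 * \<theta>))" .
  have "?a powr (2 * \<theta>) \<le> z powr (2 * \<theta>)" "z powr (2 * \<theta>) \<le> ?b powr (2 * \<theta>)"
    using z assms by (auto intro!: powr_mono2)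
  then show "snd l - sqrt (?b / ?a * ?b powr (2 * \<theta>)) \<le> shock_speed l r"
    "shock_speed l r \<le> snd l - sqrt (?b / ?a * ?a powr (2 * \<theta>))"
    unfolding s using assms
    by (auto intro!: diff_left_mono real_sqrt_le_mono mult_left_mono simp del: times_divide_eq_left)
qed

text \<open>The cases follow the type of the limit wave. If it is a proper shock or fan,
  \<open>M \<theta>\<close> eventually gives a wave of the same type. If it is trivial, the type may
  vary with \<theta>, but every wave speed then has the same limit.\<close>

lemma tendsto_wave_1:
  assumes l: "0 < fst l" and m: "0 < fst m" "snd m = snd l - wave_curve 0 (fst l) (fst m)"
    and M: "\<forall>\<^sub>F \<theta> in at_right 0. snd (M \<theta>) = snd l - wave_curve \<theta> (fst l) (fst (M \<theta>))"
    and lim: "(M \<longlongrightarrow> m) (at_right 0)"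
    and \<xi>: "\<xi> \<notin> {snd l - 1, snd m - 1, snd l - sqrt (fst m / fst l)}"
  shows "((\<lambda>\<theta>. wave_1 \<theta> l (M \<theta>) \<xi>) \<longlongrightarrow> wave_1 0 l m \<xi>) (at_right 0)"
    "\<forall>\<^sub>F \<theta> in at_right 0. \<xi> \<notin> shock_speeds_1 l (M \<theta>)"
    "\<xi> \<notin> shock_speeds_1 l m"
proof -
  let ?s = "snd l - sqrt (fst m / fst l)"
  have r: "((\<lambda>\<theta>. fst (M \<theta>)) \<longlongrightarrow> fst m) (at_right 0)" and u: "((\<lambda>\<theta>. snd (M \<theta>)) \<longlongrightarrow> snd m) (at_right 0)"
    using lim by (auto intro: tendsto_intros)
  have pos: "\<forall>\<^sub>F \<theta> in at_right 0. (0::real) < \<theta>"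
    by (rule eventually_at_right_less)
  have s0: "shock_speed l m = ?s" if "fst l < fst m"
    using shock_speed_bounds[of 0 l m] l m that by simp
  \<comment> \<open>Covers both bounds of \<open>shock_speed_bounds\<close>: with \<open>g\<close>
    the right density it is the lower one, with \<open>g\<close> constantly \<open>fst l\<close> the
    upper one. The exponent \<open>2 * \<theta>\<close> tends to 0, so both limits agree.\<close>
  have "((\<lambda>\<theta>. snd l - sqrt (f \<theta> / fst l * g \<theta> powr (2 * \<theta>))) \<longlongrightarrow> ?s) (at_right 0)"
    if "(f \<longlongrightarrow> fst m) (at_right 0)" "(g \<longlongrightarrow> c) (at_right 0)" "0 < c" for f g c
    using l that by (auto intro!: tendsto_eq_intros)
  note lo = this[OF r r m(1)] and hi = this[OF r tendsto_const l]
  have s_gt: "\<forall>\<^sub>F \<theta> in at_right 0. fst l < fst (M \<theta>) \<longrightarrow> y < shock_speed l (M \<theta>)" if "y < ?s" for y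
    using order_tendstoD(1)[OF lo that] M pos
  proof eventually_elim
    case (elim \<theta>)
    then show ?case
      using shock_speed_bounds(1)[of \<theta> l "M \<theta>"] l by auto
  qed
  have s_lt: "\<forall>\<^sub>F \<theta> in at_right 0. fst l < fst (M \<theta>) \<longrightarrow> shock_speed l (M \<theta>) < y" if "?s < y" for y
    using order_tendstoD(2)[OF hi that] M pos
  proof eventually_elim
    case (elim \<theta>)
    then show ?case
      using shock_speed_bounds(2)[of \<theta> l "M \<theta>"] l by auto
  qed
  have "((\<lambda>\<theta>. v \<theta> + (-1) ^ 1 * f \<theta> powr \<theta>) \<longlongrightarrow> w - 1) (at_right 0)"
    if "(v \<longlongrightarrow> w) (at_right 0)" "(f \<longlongrightarrow> c) (at_right 0)" "0 < c" for f v :: "real \<Rightarrow> real" and c w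
    using that by (auto intro!: tendsto_eq_intros)
  then have ev: "((\<lambda>\<theta>. eigenvalue 1 \<theta> (f \<theta>)) \<longlongrightarrow> snd c - 1) (at_right 0)"
    if "(f \<longlongrightarrow> c) (at_right 0)" "0 < fst c" for f c
    unfolding eigenvalue_def case_prod_beta using that by (blast intro: tendsto_fst tendsto_snd)
  note a = ev[OF tendsto_const l] and b = ev[OF lim m(1)]
  have e0: "eigenvalue 1 0 l = snd l - 1" "eigenvalue 1 0 m = snd m - 1"
    using l m by (auto simp: eigenvalue_def case_prod_beta)
  show "\<forall>\<^sub>F \<theta> in at_right 0. \<xi> \<notin> shock_speeds_1 l (M \<theta>)"
  proof (cases "\<xi> < ?s")
    case True
    show ?thesis
      using s_gt[OF True] by eventually_elim (auto simp: shock_speeds_1_def)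
  next
    case False
    then have *: "?s < \<xi>" using \<xi> by simp
    show ?thesis
      using s_lt[OF *] by eventually_elim (auto simp: shock_speeds_1_def)
  qed
  show "\<xi> \<notin> shock_speeds_1 l m"
    using s0 \<xi> by (auto simp: shock_speeds_1_def)
  let ?lim = "((\<lambda>\<theta>. wave_1 \<theta> l (M \<theta>) \<xi>) \<longlongrightarrow> wave_1 0 l m \<xi>) (at_right 0)"
  have const_l: ?lim if "\<forall>\<^sub>F \<theta> in at_right 0. wave_1 \<theta> l (M \<theta>) \<xi> = l" "wave_1 0 l m \<xi> = l"
    unfolding that(2) by (rule tendsto_eventually[OF that(1)])
  have const_m: ?lim if "\<forall>\<^sub>F \<theta> in at_right 0. M \<theta> = wave_1 \<theta> l (M \<theta>) \<xi>" "wave_1 0 l m \<xi> = m"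
    unfolding that(2) by (rule Lim_transform_eventually[OF lim that(1)])
  consider "fst l < fst m" | "fst m < fst l" | "fst m = fst l" by linarith
  then show ?lim
  proof cases
    case 1
    note gt = order_tendstoD(1)[OF r 1]
    show ?thesis
    proof (cases "\<xi> < ?s")
      case True
      show ?thesis
      proof (rule const_l)
        show "\<forall>\<^sub>F \<theta> in at_right 0. wave_1 \<theta> l (M \<theta>) \<xi> = l"
          using gt s_gt[OF True] by eventually_elim (simp add: wave_1_def)
        show "wave_1 0 l m \<xi> = l"
          using 1 True s0 by (simp add: wave_1_def)
      qed
    next
      case False
      then have *: "?s < \<xi>" using \<xi> by simp
      show ?thesis
      proof (rule const_m)
        show "\<forall>\<^sub>F \<theta> in at_right 0. M \<theta> = wave_1 \<theta> l (M \<theta>) \<xi>"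
          using gt s_lt[OF *] by eventually_elim (simp add: wave_1_def)
        show "wave_1 0 l m \<xi> = m"
          using 1 * s0 by (simp add: wave_1_def)
      qed
    qed
  next
    case 2
    note lt = order_tendstoD(2)[OF r 2]
    have ab: "snd l - 1 < snd m - 1"
      using wave_curve_strict_mono[of 0 "fst l" "fst m" "fst l"] 2 l m by simp
    consider "\<xi> < snd l - 1" | "snd m - 1 < \<xi>" | "snd l - 1 < \<xi>" "\<xi> < snd m - 1"
      using \<xi> by force
    then show ?thesis
    proof cases
      case A: 1
      show ?thesis
      proof (rule const_l)
        show "\<forall>\<^sub>F \<theta> in at_right 0. wave_1 \<theta> l (M \<theta>) \<xi> = l"
          using lt order_tendstoD(1)[OF a A] by eventually_elim (simp add: wave_1_def)
        show "wave_1 0 l m \<xi> = l"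
          using 2 A e0 by (simp add: wave_1_def)
      qed
    next
      case B: 2
      show ?thesis
      proof (rule const_m)
        show "\<forall>\<^sub>F \<theta> in at_right 0. M \<theta> = wave_1 \<theta> l (M \<theta>) \<xi>"
          using lt order_tendstoD(2)[OF a less_trans[OF ab B]] order_tendstoD(2)[OF b B]
          by eventually_elim (simp add: wave_1_def)
        show "wave_1 0 l m \<xi> = m"
          using 2 B e0 ab by (simp add: wave_1_def)
      qed
    next
      case C: 3
      have "\<forall>\<^sub>F \<theta> in at_right 0. fan_state 1 \<theta> (riemann_invariant 1 \<theta> l) \<xi> = wave_1 \<theta> l (M \<theta>) \<xi>"
        using lt order_tendstoD(2)[OF a C(1)] order_tendstoD(1)[OF b C(2)]
        by eventually_elim (simp add: wave_1_def)
      moreover have "wave_1 0 l m \<xi> = fan_state 1 0 (riemann_invariant 1 0 l) \<xi>"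
        using 2 C e0 by (simp add: wave_1_def)
      ultimately show ?thesis
        using Lim_transform_eventually[OF tendsto_fan_state_1[OF l]] by simp
    qed
  next
    case 3
    then have lm: "l = m"
      using m by (simp add: prod_eq_iff)
    \<comment> \<open>Now all three excluded speeds coincide, leaving only two sides to examine,
      each treated uniformly for shocks, fans and trivial waves.\<close>
    then have s: "?s = snd l - 1"
      using l by simp
    have w0: "wave_1 0 l m \<xi> = l"
      using lm by (simp add: wave_1_def)
    consider "\<xi> < snd l - 1" | "snd l - 1 < \<xi>"
      using \<xi> by force
    then show ?thesis
    proof cases
      case A: 1
      show ?thesis
      proof (rule const_l[OF _ w0])
        show "\<forall>\<^sub>F \<theta> in at_right 0. wave_1 \<theta> l (M \<theta>) \<xi> = l"
          using s_gt[of \<xi>, unfolded s, OF A] order_tendstoD(1)[OF a A]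
          by eventually_elim (simp add: wave_1_def)
      qed
    next
      case B: 2
      have b': "\<forall>\<^sub>F \<theta> in at_right 0. eigenvalue 1 \<theta> (M \<theta>) < \<xi>"
        by (rule order_tendstoD(2)[OF b]) (use B lm in simp)
      show ?thesis
      proof (rule const_m)
        show "\<forall>\<^sub>F \<theta> in at_right 0. M \<theta> = wave_1 \<theta> l (M \<theta>) \<xi>"
          using s_lt[of \<xi>, unfolded s, OF B] order_tendstoD(2)[OF a B] b' M
          by eventually_elim (auto simp: wave_1_def prod_eq_iff)
        show "wave_1 0 l m \<xi> = m"
          using w0 lm by simp
      qed
    qed
  qed
qed

section \<open>Convergence of middle states and of full profiles\<close>

text \<open>For a density \<open>y\<close> on one side of \<open>fst m\<close>, \<open>G 0 y\<close>
  differs strictly from \<open>snd L - snd R\<close>; so does \<open>G \<theta> y\<close> for small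
  \<theta>, on the same side, and monotonicity keeps the root \<open>fst (M \<theta>)\<close> from
  crossing \<open>y\<close>. The velocity then converges by
  \<open>tendsto_mono_on_compose\<close>.\<close>

lemma tendsto_intermediate_state:
  assumes pos: "0 < fst L" "0 < fst R" and m: "intermediate_state 0 L R m"
    and M: "\<forall>\<^sub>F \<theta> in at_right 0. intermediate_state \<theta> L R (M \<theta>)"
  shows "(M \<longlongrightarrow> m) (at_right 0)"
proof -
  define G where "G \<theta> r = wave_curve \<theta> (fst L) r + wave_curve \<theta> (fst R) r" for \<theta> r
  have G_mono: "G \<theta> r < G \<theta> s" if "0 \<le> \<theta>" "0 < r" "r < s" for \<theta> r s
    unfolding G_def using that pos by (intro add_strict_mono wave_curve_strict_mono)
  have G_lim: "((\<lambda>\<theta>. G \<theta> r) \<longlongrightarrow> G 0 r) (at_right 0)" if "0 < r" for r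
    unfolding G_def using that pos by (intro tendsto_add tendsto_wave_curve)
  have Gm: "G 0 (fst m) = snd L - snd R" "0 < fst m"
    using m by (simp_all add: G_def intermediate_state_def)
  have GM: "\<forall>\<^sub>F \<theta> in at_right 0. 0 < \<theta> \<and> 0 < fst (M \<theta>) \<and> G \<theta> (fst (M \<theta>)) = snd L - snd R
      \<and> snd (M \<theta>) = snd L - wave_curve \<theta> (fst L) (fst (M \<theta>))"
    using M eventually_at_right_less
    by eventually_elim (simp add: G_def intermediate_state_def)
  have r: "((\<lambda>\<theta>. fst (M \<theta>)) \<longlongrightarrow> fst m) (at_right 0)"
  proof (rule order_tendstoI)
    fix y assume "y < fst m"
    \<comment> \<open>The maximum keeps the test density positive even if \<open>y\<close> is
      not.\<close>
    define a where "a = max y (fst m / 2)"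
    have a: "0 < a" "a < fst m" "y \<le> a"
      using \<open>y < fst m\<close> Gm(2) by (auto simp: a_def)
    have "G 0 a < snd L - snd R"
      using G_mono[of 0 a "fst m"] a Gm by simp
    from order_tendstoD(2)[OF G_lim[OF a(1)] this] GM
    show "\<forall>\<^sub>F \<theta> in at_right 0. y < fst (M \<theta>)"
    proof eventually_elim
      case (elim \<theta>)
      then have "\<not> fst (M \<theta>) \<le> a"
        using G_mono[of \<theta> "fst (M \<theta>)" a] by force
      then show ?case using a(3) by simp
    qed
  next
    fix y assume y: "fst m < y"
    then have "snd L - snd R < G 0 y" "0 < y"
      using G_mono[of 0 "fst m" y] Gm by simp_all
    from order_tendstoD(1)[OF G_lim[OF this(2)] this(1)] GM
    show "\<forall>\<^sub>F \<theta> in at_right 0. fst (M \<theta>) < y"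
    proof eventually_elim
      case (elim \<theta>)
      then have "\<not> y \<le> fst (M \<theta>)"
        using G_mono[of \<theta> y "fst (M \<theta>)"] \<open>0 < y\<close> by force
      then show ?case by simp
    qed
  qed
  have "((\<lambda>\<theta>. wave_curve \<theta> (fst L) (fst (M \<theta>))) \<longlongrightarrow> wave_curve 0 (fst L) (fst m)) (at_right 0)"
  proof (rule tendsto_mono_on_compose[OF _ tendsto_wave_curve[OF pos(1)] _ Gm(2) r])
    show "\<forall>\<^sub>F \<theta> in at_right 0. \<forall>a b. 0 < a \<and> a \<le> b \<longrightarrow> wave_curve \<theta> (fst L) a \<le> wave_curve \<theta> (fst L) b"
      using eventually_at_right_less
    proof eventually_elim
      case (elim \<theta>)
      then show ?case
        using wave_curve_strict_mono[of \<theta> "fst L"] pos(1) by (metis less_eq_real_def)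
    qed
    show "isCont (wave_curve 0 (fst L)) (fst m)"
      using continuous_on_wave_curve[of 0 "fst L"] pos(1) Gm(2)
      by (simp add: continuous_on_eq_continuous_at)
  qed
  then have "((\<lambda>\<theta>. snd L - wave_curve \<theta> (fst L) (fst (M \<theta>))) \<longlongrightarrow> snd m) (at_right 0)"
    using m by (auto intro!: tendsto_eq_intros simp: intermediate_state_def)
  then have u: "((\<lambda>\<theta>. snd (M \<theta>)) \<longlongrightarrow> snd m) (at_right 0)"
    by (rule Lim_transform_eventually) (use GM in \<open>auto elim: eventually_mono\<close>)
  show ?thesis
    using tendsto_Pair[OF r u] by simp
qed

text \<open>Limits, as \<open>\<theta>\<close> tends to 0, of the speeds \<open>\<lambda>\<^sub>1(l)\<close> and \<open>\<lambda>\<^sub>1(m)\<close> and of the 1-shock speed.\<close>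

definition critical_speeds :: "state \<Rightarrow> state \<Rightarrow> real set" where
  "critical_speeds l m = {snd l - 1, snd m - 1, snd l - sqrt (fst m / fst l)}"

lemma tendsto_mirror:
  assumes "(f \<longlongrightarrow> s) F"
  shows "((\<lambda>x. mirror (f x)) \<longlongrightarrow> mirror s) F"
  unfolding mirror_def case_prod_beta using assms by (intro tendsto_intros)

lemma intermediate_state_waves:
  assumes "intermediate_state \<theta> L R M"
  shows "snd M = snd L - wave_curve \<theta> (fst L) (fst M)"
    "snd (mirror M) = snd (mirror R) - wave_curve \<theta> (fst (mirror R)) (fst (mirror M))"
  using assms by (simp_all add: intermediate_state_def)

text \<open>As \<open>\<xi>\<close> differs from \<open>snd m\<close>, the cut at
  \<open>snd (M \<theta>)\<close> is eventually on the same side of \<open>\<xi>\<close> as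
  \<open>snd m\<close>. Each side is then an instance of \<open>tendsto_wave_1\<close>, the right
  one after reflection.\<close>

lemma tendsto_solution_profile:
  assumes pos: "0 < fst L" "0 < fst R" and m: "intermediate_state 0 L R m"
    and M: "\<forall>\<^sub>F \<theta> in at_right 0. intermediate_state \<theta> L R (M \<theta>)"
    and \<xi>: "\<xi> \<noteq> snd m" "\<xi> \<notin> critical_speeds L m" "- \<xi> \<notin> critical_speeds (mirror R) (mirror m)"
  shows "((\<lambda>\<theta>. solution_profile \<theta> L R (M \<theta>) \<xi>) \<longlongrightarrow> solution_profile 0 L R m \<xi>) (at_right 0)"
    "\<forall>\<^sub>F \<theta> in at_right 0. \<xi> \<notin> solution_speeds L R (M \<theta>)"
    "\<xi> \<notin> solution_speeds L R m"
proof -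
  have lim: "(M \<longlongrightarrow> m) (at_right 0)"
    using tendsto_intermediate_state[OF pos m M] .
  then have u: "((\<lambda>\<theta>. snd (M \<theta>)) \<longlongrightarrow> snd m) (at_right 0)"
    by (rule tendsto_snd)
  have m0: "0 < fst m"
    using m by (simp add: intermediate_state_def)
  have M1: "\<forall>\<^sub>F \<theta> in at_right 0. snd (M \<theta>) = snd L - wave_curve \<theta> (fst L) (fst (M \<theta>))"
    and M2: "\<forall>\<^sub>F \<theta> in at_right 0. snd (mirror (M \<theta>))
      = snd (mirror R) - wave_curve \<theta> (fst (mirror R)) (fst (mirror (M \<theta>)))"
    using M by (auto elim!: eventually_mono dest: intermediate_state_waves)
  note w1 = tendsto_wave_1[OF pos(1) m0 intermediate_state_waves(1)[OF m]
      M1 lim \<xi>(2)[unfolded critical_speeds_def]]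
  have "0 < fst (mirror R)" "0 < fst (mirror m)"
    using pos m0 by simp_all
  note w2 = tendsto_wave_1[OF this intermediate_state_waves(2)[OF m]
      M2 tendsto_mirror[OF lim]
      \<xi>(3)[unfolded critical_speeds_def]]
  show "\<xi> \<notin> solution_speeds L R m"
    using w1(3) w2(3) by (auto simp: solution_speeds_def)
  show "\<forall>\<^sub>F \<theta> in at_right 0. \<xi> \<notin> solution_speeds L R (M \<theta>)"
    using w1(2) w2(2) by eventually_elim (auto simp: solution_speeds_def)
  show "((\<lambda>\<theta>. solution_profile \<theta> L R (M \<theta>) \<xi>) \<longlongrightarrow> solution_profile 0 L R m \<xi>) (at_right 0)"
  proof (cases "\<xi> < snd m")
    case True
    have "\<forall>\<^sub>F \<theta> in at_right 0. wave_1 \<theta> L (M \<theta>) \<xi> = solution_profile \<theta> L R (M \<theta>) \<xi>"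
      using order_tendstoD(1)[OF u True] by eventually_elim (simp add: solution_profile_def)
    with w1(1) have "((\<lambda>\<theta>. solution_profile \<theta> L R (M \<theta>) \<xi>) \<longlongrightarrow> wave_1 0 L m \<xi>) (at_right 0)"
      by (rule Lim_transform_eventually)
    then show ?thesis
      using True by (simp add: solution_profile_def[of 0])
  next
    case False
    then have *: "snd m < \<xi>"
      using \<xi>(1) by simp
    have "\<forall>\<^sub>F \<theta> in at_right 0. mirror (wave_1 \<theta> (mirror R) (mirror (M \<theta>)) (- \<xi>))
        = solution_profile \<theta> L R (M \<theta>) \<xi>"
      using order_tendstoD(2)[OF u *] by eventually_elim (simp add: solution_profile_def)
    with tendsto_mirror[OF w2(1)] have "((\<lambda>\<theta>. solution_profile \<theta> L R (M \<theta>) \<xi>)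
        \<longlongrightarrow> mirror (wave_1 0 (mirror R) (mirror m) (- \<xi>))) (at_right 0)"
      by (rule Lim_transform_eventually)
    then show ?thesis
      using * by (simp add: solution_profile_def[of 0])
  qed
qed

text \<open>Isothermal fans are exponentials and never reach vacuum. Positivity of the limit later
  gives positivity of the density for small \<theta>.\<close>

lemma solution_profile_0_pos:
  assumes "0 < fst L" "0 < fst R" "0 < fst m"
  shows "0 < fst (solution_profile 0 L R m \<xi>)"
  using assms
  by (auto simp: solution_profile_def wave_1_def fan_state_def riemann_invariant_def case_prod_beta)

text \<open>Multiplied by \<theta>, the difference of the two invariants tends to -2, since both
  powers tend to 1.\<close>

lemma eventually_no_vacuum:
  assumes "0 < fst L" "0 < fst R"
  shows "\<forall>\<^sub>F \<theta> in at_right 0. riemann_invariant 2 \<theta> R < riemann_invariant 1 \<theta> L"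
proof -
  have "((\<lambda>\<theta>. \<theta> * (snd R - snd L) - fst L powr \<theta> - fst R powr \<theta>) \<longlongrightarrow> - 2) (at_right 0)"
    using assms by (auto intro!: tendsto_eq_intros)
  then have "\<forall>\<^sub>F \<theta> in at_right 0. \<theta> * (snd R - snd L) - fst L powr \<theta> - fst R powr \<theta> < 0"
    by (rule order_tendstoD) simp
  then show ?thesis
    using eventually_at_right_less
  proof eventually_elim
    case (elim \<theta>)
    have "\<theta> * (snd R - snd L) - fst L powr \<theta> - fst R powr \<theta>
        = \<theta> * (snd R - snd L - fst L powr \<theta> / \<theta> - fst R powr \<theta> / \<theta>)"
      using elim by (simp add: right_diff_distrib)
    then have "snd R - snd L - fst L powr \<theta> / \<theta> - fst R powr \<theta> / \<theta> < 0"
      using elim by (simp add: mult_less_0_iff)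
    then show ?case
      using elim by (simp add: riemann_invariant_def case_prod_beta)
  qed
qed

lemma riemann_solution_eq_profile:
  assumes "riemann_solution \<theta> L R S \<rho> u" "intermediate_state \<theta> L R M" "0 \<le> \<theta>" "0 < fst L" "0 < fst R"
    and "0 < t" "x / t \<notin> solution_speeds L R M"
  shows "\<rho> t x = fst (solution_profile \<theta> L R M (x / t))" "u t x = snd (solution_profile \<theta> L R M (x / t))"
proof -
  obtain V where V: "nonvacuum_profile \<theta> L R S V \<or> S = {} \<and> vacuum_profile \<theta> L R V"
    "\<rho> t x = fst (V (x / t))" "u t x = snd (V (x / t))"
    using riemann_solutionE[OF assms(1)] assms(6) by metis
  have "nonvacuum_profile \<theta> L R S V"
    using V(1) intermediate_state_no_vacuum[OF assms(2)] assms(4,5)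
    by (auto simp: vacuum_profile_def Let_def)
  then obtain N where "intermediate_state \<theta> L R N" "S = solution_speeds L R N"
    "\<And>\<xi>. \<xi> \<notin> S \<Longrightarrow> V \<xi> = solution_profile \<theta> L R N \<xi>"
    using assms(3) by (rule nonvacuum_profileD) blast
  then have "V (x / t) = solution_profile \<theta> L R M (x / t)"
    using intermediate_state_unique[OF assms(2) _ assms(3-5)] assms(7) by blast
  then show "\<rho> t x = fst (solution_profile \<theta> L R M (x / t))"
    "u t x = snd (solution_profile \<theta> L R M (x / t))"
    using V(2,3) by simp_all
qed

section \<open>Exceptional rays and the final assembly\<close>

text \<open>For t > 0 each excluded slope \<open>c\<close> confines (t, x) to the line orthogonal to
  \<open>(c, - 1)\<close>, a null set.\<close>

lemma AE_slope_notin_finite: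
  assumes "finite E"
  shows "AE (t, x) in lborel. 0 < t \<longrightarrow> x / t \<notin> (E :: real set)"
proof -
  have "AE z in lborel. (c, - 1 :: real) \<bullet> z \<noteq> 0" for c :: real
  proof -
    have "negligible {z. (c, - 1 :: real) \<bullet> z = (0 :: real)}"
      by (rule negligible_hyperplane) (simp add: zero_prod_def)
    moreover have "{z. (c, - 1 :: real) \<bullet> z = (0 :: real)} \<in> sets borel"
      by (intro borel_closed closed_hyperplane)
    ultimately have "{z. (c, - 1 :: real) \<bullet> z = (0 :: real)} \<in> null_sets lborel"
      by (simp add: negligible_iff_null_sets null_sets_def)
    then show ?thesis
      using AE_not_in by fastforce
  qed
  then have "AE z in lborel. \<forall>c\<in>E. (c, - 1 :: real) \<bullet> z \<noteq> (0 :: real)"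
    using assms by (intro AE_finite_allI) auto
  then show ?thesis
    by (rule AE_mp) (auto intro!: AE_I2 simp: inner_prod_def)
qed

theorem proposition7p1:
  fixes \<rho>L uL \<rho>R uR :: real
  assumes "0 < \<rho>L" and "0 < \<rho>R"
  shows
    "(\<forall>\<theta>\<ge>0. \<exists>S \<rho> u. riemann_solution \<theta> (\<rho>L, uL) (\<rho>R, uR) S \<rho> u \<and>
        (\<forall>S' \<rho>' u'. riemann_solution \<theta> (\<rho>L, uL) (\<rho>R, uR) S' \<rho>' u' \<longrightarrow>
           S' = S \<and>
           (\<forall>t>0. \<forall>x. x / t \<notin> S \<longrightarrow>
              \<rho>' t x = \<rho> t x \<and> (0 < \<rho> t x \<longrightarrow> u' t x = u t x)))) \<and>
     (\<forall>\<rho> u :: real \<Rightarrow> real \<Rightarrow> real \<Rightarrow> real.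
        (\<forall>\<theta>\<ge>0. \<exists>S. riemann_solution \<theta> (\<rho>L, uL) (\<rho>R, uR) S (\<rho> \<theta>) (u \<theta>)) \<longrightarrow>
        (AE (t, x) in lborel. 0 < t \<longrightarrow>
           ((\<lambda>\<theta>. \<rho> \<theta> t x) \<longlongrightarrow> \<rho> 0 t x) (at_right 0) \<and>
           (\<forall>\<^sub>F \<theta> in at_right 0. 0 < \<rho> \<theta> t x) \<and>
           ((\<lambda>\<theta>. u \<theta> t x) \<longlongrightarrow> u 0 t x) (at_right 0)))"
proof (intro conjI allI impI)
  show "\<exists>S \<rho> u. riemann_solution \<theta> (\<rho>L, uL) (\<rho>R, uR) S \<rho> u \<and>
        (\<forall>S' \<rho>' u'. riemann_solution \<theta> (\<rho>L, uL) (\<rho>R, uR) S' \<rho>' u' \<longrightarrow>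
           S' = S \<and>
           (\<forall>t>0. \<forall>x. x / t \<notin> S \<longrightarrow>
              \<rho>' t x = \<rho> t x \<and> (0 < \<rho> t x \<longrightarrow> u' t x = u t x)))" if "0 \<le> \<theta>" for \<theta>
    using that assms by (intro ex1_riemann_solution) auto
next
  fix \<rho> u :: "real \<Rightarrow> real \<Rightarrow> real \<Rightarrow> real"
  assume sol: "\<forall>\<theta>\<ge>0. \<exists>S. riemann_solution \<theta> (\<rho>L, uL) (\<rho>R, uR) S (\<rho> \<theta>) (u \<theta>)"
  define L R where "L = (\<rho>L, uL)" and "R = (\<rho>R, uR)"
  have pos: "0 < fst L" "0 < fst R"
    using assms by (simp_all add: L_def R_def)
  obtain m where m: "intermediate_state 0 L R m"
    using ex_intermediate_state[of 0 L R] pos by auto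
  \<comment> \<open>The choice is meaningful once \<theta> is small enough to exclude vacuum; only
    eventual statements about \<open>M\<close> are used.\<close>
  define M where "M \<theta> = (SOME M. intermediate_state \<theta> L R M)" for \<theta>
  have M: "\<forall>\<^sub>F \<theta> in at_right 0. intermediate_state \<theta> L R (M \<theta>)"
    using eventually_no_vacuum[OF pos] eventually_at_right_less
  proof eventually_elim
    case (elim \<theta>)
    then show ?case
      unfolding M_def using pos by (intro someI_ex[OF ex_intermediate_state]) auto
  qed
  \<comment> \<open>Limit speeds of both waves, those of the 2-wave reflected back, together with
    the point where the profile switches formula.\<close>
  define E where "E = insert (snd m) (critical_speeds L m \<union> uminus ` critical_speeds (mirror R) (mirror m))"
  have conv: "((\<lambda>\<theta>. \<rho> \<theta> t x) \<longlongrightarrow> \<rho> 0 t x) (at_right 0) \<and>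
      (\<forall>\<^sub>F \<theta> in at_right 0. 0 < \<rho> \<theta> t x) \<and> ((\<lambda>\<theta>. u \<theta> t x) \<longlongrightarrow> u 0 t x) (at_right 0)"
    if t: "0 < t" and x: "x / t \<notin> E" for t x
  proof -
    let ?\<xi> = "x / t"
    have "?\<xi> \<noteq> snd m" "?\<xi> \<notin> critical_speeds L m" "- ?\<xi> \<notin> critical_speeds (mirror R) (mirror m)"
      using x unfolding E_def by (auto simp: image_iff)
    note lim = tendsto_solution_profile[OF pos m M this]
    have eq: "fst (solution_profile \<theta> L R N ?\<xi>) = \<rho> \<theta> t x" "snd (solution_profile \<theta> L R N ?\<xi>) = u \<theta> t x"
      if "0 \<le> \<theta>" "intermediate_state \<theta> L R N" "?\<xi> \<notin> solution_speeds L R N" for \<theta> N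
    proof -
      obtain S where "riemann_solution \<theta> L R S (\<rho> \<theta>) (u \<theta>)"
        using sol \<open>0 \<le> \<theta>\<close> unfolding L_def R_def by blast
      from riemann_solution_eq_profile[OF this that(2,1) pos t that(3)]
      show "fst (solution_profile \<theta> L R N ?\<xi>) = \<rho> \<theta> t x" "snd (solution_profile \<theta> L R N ?\<xi>) = u \<theta> t x"
        by simp_all
    qed
    note eq0 = eq[OF order_refl m lim(3)]
    have ev: "\<forall>\<^sub>F \<theta> in at_right 0. fst (solution_profile \<theta> L R (M \<theta>) ?\<xi>) = \<rho> \<theta> t x"
      "\<forall>\<^sub>F \<theta> in at_right 0. snd (solution_profile \<theta> L R (M \<theta>) ?\<xi>) = u \<theta> t x"
      using M lim(2) eventually_at_right_less by (eventually_elim, simp add: eq)+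
    have \<rho>: "((\<lambda>\<theta>. \<rho> \<theta> t x) \<longlongrightarrow> \<rho> 0 t x) (at_right 0)"
      using Lim_transform_eventually[OF tendsto_fst[OF lim(1)] ev(1)] unfolding eq0 .
    have "0 < \<rho> 0 t x"
      using solution_profile_0_pos[OF pos, of m ?\<xi>] m eq0 by (simp add: intermediate_state_def)
    then show ?thesis
      using \<rho> order_tendstoD(1)[OF \<rho>]
        Lim_transform_eventually[OF tendsto_snd[OF lim(1)] ev(2), unfolded eq0] by blast
  qed
  have "finite E"
    by (simp add: E_def critical_speeds_def)
  then show "AE (t, x) in lborel. 0 < t \<longrightarrow>
      ((\<lambda>\<theta>. \<rho> \<theta> t x) \<longlongrightarrow> \<rho> 0 t x) (at_right 0) \<and>
      (\<forall>\<^sub>F \<theta> in at_right 0. 0 < \<rho> \<theta> t x) \<and>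
      ((\<lambda>\<theta>. u \<theta> t x) \<longlongrightarrow> u 0 t x) (at_right 0)"
    by (rule AE_mp[OF AE_slope_notin_finite]) (auto intro!: AE_I2 dest: conv)
qed

end
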